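(* Let $q>0$ be real. The algebras $\mathcal A(\mathbb{R}^4_\theta)[\tilde\rho\,]$ and $[\rho]\mathcal A(\widetilde{\mathbb{R}}{}^4_\theta)$ are isomorphic as $*$-algebras in the category of left $\mathcal H_\theta$-comodules.
   Context: $q=\exp(\tfrac{\mathrm i}{2}\theta)$ with $\theta$ purely imaginary. $\mathcal A(\mathbb{G}\mathrm r_\theta(2;4))$ is the graded $\mathbb{C}$-algebra generated by degree-one elements $\Lambda^{(ij)}$, $1\le i<j\le4$, with relations $\Lambda^{(j_1j_2)}\Lambda^{(k_1k_2)}=\big(\prod_{\alpha,\beta=1}^2q_{j_\alpha k_\beta}^2\big)\Lambda^{(k_1k_2)}\Lambda^{(j_1j_2)}$, where $q_{12}=q=q_{21}^{-1}$ and $q_{ij}=1$ otherwise, together with the Plücker relation $\Lambda^{(12)}\Lambda^{(34)}-q^{-1}\Lambda^{(13)}\Lambda^{(24)}+q\,\Lambda^{(23)}\Lambda^{(14)}=0$. It is a $*$-algebra via the conjugate linear anti-homomorphism with $\Lambda^{(13)\dagger}=q\Lambda^{(24)}$, $\Lambda^{(14)\dagger}=-q^{-1}\Lambda^{(23)}$, $\Lambda^{(12)\dagger}=\Lambda^{(12)}$, $\Lambda^{(34)\dagger}=\Lambda^{(34)}$. $\mathcal H_\theta=\mathbb{C}[t_1^{\pm1},t_2^{\pm1}]$ is the Hopf algebra of the torus $(\mathbb{C}^\times)^2$ (with group-like $t_i$); a left $\mathcal H_\theta$-comodule structure is a $\mathbb{Z}^2$-grading. The powers of $\Lambda^{(34)}$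 and of $\Lambda^{(12)}$ are denominator sets. $\mathcal A(\mathbb{R}^4_\theta)$ is the degree-zero part of the localization at $\Lambda^{(34)}$ and is generated by $\xi_1=-\Lambda^{(14)}\Lambda^{(34)\,-1}$, $\xi_2=-\Lambda^{(24)}\Lambda^{(34)\,-1}$, $\bar\xi_1=\Lambda^{(23)}\Lambda^{(34)\,-1}$, $\bar\xi_2=\Lambda^{(13)}\Lambda^{(34)\,-1}$, with $\rho=q\Lambda^{(12)}\Lambda^{(34)\,-1}=\xi_1\bar\xi_1-\bar\xi_2\xi_2$; involution $\xi_1^\dagger=q^{-1}\bar\xi_1$, $\xi_2^\dagger=-q^{-1}\bar\xi_2$; coaction: $\xi_1,\bar\xi_2$ have weight $t_1$ and $\xi_2,\bar\xi_1$ weight $t_2$. $\mathcal A(\widetilde{\mathbb{R}}{}^4_\theta)$ is the degree-zero part of the left localization at $\Lambda^{(12)}$ and is generated by $\zeta_1=-\Lambda^{(12)\,-1}\Lambda^{(14)}$, $\zeta_2=-\Lambda^{(12)\,-1}\Lambda^{(24)}$, $\bar\zeta_1=\Lambda^{(12)\,-1}\Lambda^{(23)}$, $\bar\zeta_2=\Lambda^{(12)\,-1}\Lambda^{(13)}$, with $\tilde\rho=q\Lambda^{(12)\,-1}\Lambda^{(34)}=q^2\zeta_1\bar\zeta_1-q^2\bar\zeta_2\zeta_2$; involution $\zeta_1^\dagger=q\bar\zeta_1$, $\zeta_2^\dagger=-q^{-3}\bar\zeta_2$; coaction: $\zeta_1,\bar\zeta_2$ have weight $t_2^{-1}$ and $\zeta_2,\bar\zeta_1$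 weight $t_1^{-1}$. $\mathcal A(\mathbb{R}^4_\theta)[\tilde\rho\,]$ is obtained from $\mathcal A(\mathbb{R}^4_\theta)$ by adjoining the element $\tilde\rho$ (a scalar multiple of $\rho^{-1}$, of weight $(t_1t_2)^{-1}$), and $[\rho]\mathcal A(\widetilde{\mathbb{R}}{}^4_\theta)$ from $\mathcal A(\widetilde{\mathbb{R}}{}^4_\theta)$ by adjoining $\rho$ (a scalar multiple of $\tilde\rho^{-1}$, of weight $t_1t_2$), both inside the localization of $\mathcal A(\mathbb{G}\mathrm r_\theta(2;4))$ at $\Lambda^{(12)}$ and $\Lambda^{(34)}$. An isomorphism of $*$-algebras in the comodule category is an algebra isomorphism commuting with $\dagger$ and with the coactions. *)

theory Defs
  imports
    "HOL-Algebra.Algebra"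
    "HOL-Algebra.Algebraic_Closure_Type"
    "HOL-Library.Poly_Mapping"
    "HOL-Library.Product_Plus"
    Complex_Main
begin

subsection \<open>Comodule star-algebras\<close>

text \<open>
  A left comodule over $\mathbb{C}[t_1^{\pm1},t_2^{\pm1}]$ with group-like $t_i$ is a
  $\mathbb{Z}^2$-grading: \<open>wt A (m, n)\<close> is the subspace on which the coaction is
  $a \mapsto t_1^m t_2^n \otimes a$.
\<close>

record 'a star_comodule = "(complex, 'a) module" +
  star :: "'a \<Rightarrow> 'a"
  wt :: "int \<times> int \<Rightarrow> 'a set"

abbreviation complex_field :: "complex ring" where
  "complex_field \<equiv> ring_of_type_algebra"

locale comodule_star_algebra = ring A + module complex_field A
  for A :: "('a, 'm) star_comodule_scheme" (structure) +
  assumes smult_mult_left: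
      "\<lbrakk>x \<in> carrier A; y \<in> carrier A\<rbrakk> \<Longrightarrow> (c \<odot> x) \<otimes> y = c \<odot> (x \<otimes> y)"
    and smult_mult_right:
      "\<lbrakk>x \<in> carrier A; y \<in> carrier A\<rbrakk> \<Longrightarrow> x \<otimes> (c \<odot> y) = c \<odot> (x \<otimes> y)"
    and star_closed: "x \<in> carrier A \<Longrightarrow> star A x \<in> carrier A"
    and star_involution: "x \<in> carrier A \<Longrightarrow> star A (star A x) = x"
    and star_add:
      "\<lbrakk>x \<in> carrier A; y \<in> carrier A\<rbrakk> \<Longrightarrow> star A (x \<oplus> y) = star A x \<oplus> star A y"
    and star_smult: "x \<in> carrier A \<Longrightarrow> star A (c \<odot> x) = cnj c \<odot> star A x"
    and star_mult:
      "\<lbrakk>x \<in> carrier A; y \<in> carrier A\<rbrakk> \<Longrightarrow> star A (x \<otimes> y) = star A y \<otimes> star A x"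
    and wt_submodule: "submodule (wt A w) complex_field A"
    and wt_decomposition:
      "x \<in> carrier A \<Longrightarrow>
        \<exists>!f. (\<forall>w. f w \<in> wt A w) \<and> finite {w. f w \<noteq> \<zero>} \<and> x = (\<Oplus>w\<in>{w. f w \<noteq> \<zero>}. f w)"
    and wt_one: "\<one> \<in> wt A 0"
    and wt_mult: "\<lbrakk>x \<in> wt A u; y \<in> wt A v\<rbrakk> \<Longrightarrow> x \<otimes> y \<in> wt A (u + v)"

definition comodule_star_iso ::
    "('a, 'm) star_comodule_scheme \<Rightarrow> ('b, 'n) star_comodule_scheme \<Rightarrow> ('a \<Rightarrow> 'b) set" where
  "comodule_star_iso A B =
    {\<phi> \<in> ring_iso A B.
      (\<forall>c. \<forall>x\<in>carrier A. \<phi> (c \<odot>\<^bsub>A\<^esub> x) = c \<odot>\<^bsub>B\<^esub> \<phi> x) \<and>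
      (\<forall>x\<in>carrier A. \<phi> (star A x) = star B (\<phi> x)) \<and>
      (\<forall>w. \<forall>x\<in>wt A w. \<phi> x \<in> wt B w)}"

definition comodule_star_isomorphic ::
    "('a, 'm) star_comodule_scheme \<Rightarrow> ('b, 'n) star_comodule_scheme \<Rightarrow> bool" where
  "comodule_star_isomorphic A B \<longleftrightarrow>
    comodule_star_algebra A \<and> comodule_star_algebra B \<and> comodule_star_iso A B \<noteq> {}"


subsection \<open>Ore localization\<close>

text \<open>
  The right ring of fractions of \<open>R\<close> at a right denominator set \<open>S\<close>; the pair \<open>(a, s)\<close>
  stands for $a s^{-1}$.  When \<open>S\<close> is a denominator set, all members of the unions below
  coincide.  The product uses $s^{-1} b = c u^{-1}$ whenever $b u = s c$.
\<close>

definition ore_rel :: "('a, 'm) ring_scheme \<Rightarrow> 'a set \<Rightarrow> (('a \<times> 'a) \<times> ('a \<times> 'a)) set" where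
  "ore_rel R S = {((a, s), (b, t)).
    a \<in> carrier R \<and> b \<in> carrier R \<and> s \<in> S \<and> t \<in> S \<and>
    (\<exists>u\<in>carrier R. \<exists>v\<in>carrier R.
      s \<otimes>\<^bsub>R\<^esub> u = t \<otimes>\<^bsub>R\<^esub> v \<and> s \<otimes>\<^bsub>R\<^esub> u \<in> S \<and> a \<otimes>\<^bsub>R\<^esub> u = b \<otimes>\<^bsub>R\<^esub> v)}"

definition ore_frac :: "('a, 'm) ring_scheme \<Rightarrow> 'a set \<Rightarrow> 'a \<Rightarrow> 'a \<Rightarrow> ('a \<times> 'a) set" where
  "ore_frac R S a s = ore_rel R S `` {(a, s)}"

definition ore_localization :: "('a, 'm) ring_scheme \<Rightarrow> 'a set \<Rightarrow> ('a \<times> 'a) set ring" where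
  "ore_localization R S =
    \<lparr>carrier = (carrier R \<times> S) // ore_rel R S,
     monoid.mult = (\<lambda>F G. \<Union>{ore_frac R S (a \<otimes>\<^bsub>R\<^esub> c) (t \<otimes>\<^bsub>R\<^esub> u) | a s b t c u.
       (a, s) \<in> F \<and> (b, t) \<in> G \<and> c \<in> carrier R \<and> u \<in> S \<and> b \<otimes>\<^bsub>R\<^esub> u = s \<otimes>\<^bsub>R\<^esub> c}),
     one = ore_frac R S \<one>\<^bsub>R\<^esub> \<one>\<^bsub>R\<^esub>,
     ring.zero = ore_frac R S \<zero>\<^bsub>R\<^esub> \<one>\<^bsub>R\<^esub>,
     add = (\<lambda>F G. \<Union>{ore_frac R S (a \<otimes>\<^bsub>R\<^esub> u \<oplus>\<^bsub>R\<^esub> b \<otimes>\<^bsub>R\<^esub> v) (s \<otimes>\<^bsub>R\<^esub> u) | a s b t u v.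
       (a, s) \<in> F \<and> (b, t) \<in> G \<and> u \<in> carrier R \<and> v \<in> carrier R \<and>
       s \<otimes>\<^bsub>R\<^esub> u = t \<otimes>\<^bsub>R\<^esub> v \<and> s \<otimes>\<^bsub>R\<^esub> u \<in> S})\<rparr>"


subsection \<open>The free algebra on the Pluecker generators\<close>

datatype pluecker = P12 | P13 | P14 | P23 | P24 | P34

primrec indices :: "pluecker \<Rightarrow> nat list" where
  "indices P12 = [1, 2]"
| "indices P13 = [1, 3]"
| "indices P14 = [1, 4]"
| "indices P23 = [2, 3]"
| "indices P24 = [2, 4]"
| "indices P34 = [3, 4]"

text \<open>
  Words, with concatenation written as \<open>+\<close> (not commutative), since \<^typ>\<open>'a \<Rightarrow>\<^sub>0 complex\<close> is
  the monoid algebra of an additively written monoid.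
\<close>

datatype 'a free_monoid = Free_Monoid (letters: "'a list")

instantiation free_monoid :: (type) monoid_add
begin

definition zero_free_monoid :: "'a free_monoid" where
  "0 = Free_Monoid []"

definition plus_free_monoid :: "'a free_monoid \<Rightarrow> 'a free_monoid \<Rightarrow> 'a free_monoid" where
  "v + w = Free_Monoid (letters v @ letters w)"

instance
  by standard (simp_all add: zero_free_monoid_def plus_free_monoid_def)

end

type_synonym free_alg = "pluecker free_monoid \<Rightarrow>\<^sub>0 complex"

definition gen :: "pluecker \<Rightarrow> free_alg" where
  "gen g = Poly_Mapping.single (Free_Monoid [g]) 1"

definition const :: "complex \<Rightarrow> free_alg" where
  "const c = Poly_Mapping.single 0 c"

text \<open>
  The values at \<open>P23\<close> and \<open>P24\<close> are forced by those at \<open>P14\<close> and \<open>P13\<close>, since \<open>q\<close> is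
  real and the involution is conjugate linear of order two.
\<close>

definition gen_star :: "real \<Rightarrow> pluecker \<Rightarrow> free_alg" where
  "gen_star q g = (case g of
      P12 \<Rightarrow> gen P12
    | P34 \<Rightarrow> gen P34
    | P13 \<Rightarrow> const (of_real q) * gen P24
    | P24 \<Rightarrow> const (of_real (inverse q)) * gen P13
    | P14 \<Rightarrow> - const (of_real (inverse q)) * gen P23
    | P23 \<Rightarrow> - const (of_real q) * gen P14)"

definition free_star :: "real \<Rightarrow> free_alg \<Rightarrow> free_alg" where
  "free_star q p =
    (\<Sum>w\<in>Poly_Mapping.keys p. const (cnj (Poly_Mapping.lookup p w)) * prod_list (map (gen_star q) (rev (letters w))))"

text \<open>
  $\Lambda^{(ij)}$ has weight $t_i t_j$, where $t_3 = t_4 = 1$; this gives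
  $\xi_1, \bar\xi_2$ the weight $t_1$, $\xi_2, \bar\xi_1$ the weight $t_2$,
  $\zeta_1, \bar\zeta_2$ the weight $t_2^{-1}$ and $\zeta_2, \bar\zeta_1$ the weight $t_1^{-1}$.
\<close>

definition gen_weight :: "pluecker \<Rightarrow> int \<times> int" where
  "gen_weight g = (int (count_list (indices g) 1), int (count_list (indices g) 2))"

definition word_weight :: "pluecker free_monoid \<Rightarrow> int \<times> int" where
  "word_weight w = (\<Sum>g\<leftarrow>letters w. gen_weight g)"


subsection \<open>The noncommutative Grassmannian\<close>

definition q_coeff :: "real \<Rightarrow> nat \<Rightarrow> nat \<Rightarrow> real" where
  "q_coeff q i j = (if i = 1 \<and> j = 2 then q else if i = 2 \<and> j = 1 then inverse q else 1)"

definition relations :: "real \<Rightarrow> free_alg set" where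
  "relations q =
    {gen g * gen h
       - const (of_real (\<Prod>j\<leftarrow>indices g. \<Prod>k\<leftarrow>indices h. (q_coeff q j k)\<^sup>2)) * (gen h * gen g)
     | g h. True} \<union>
    {gen P12 * gen P34
       - const (of_real (inverse q)) * (gen P13 * gen P24)
       + const (of_real q) * (gen P23 * gen P14)}"

abbreviation free_ring :: "free_alg ring" where
  "free_ring \<equiv> ring_of_type_algebra"

definition rel_ideal :: "real \<Rightarrow> free_alg set" where
  "rel_ideal q = genideal free_ring (relations q)"

definition Gr :: "real \<Rightarrow> free_alg set ring" where
  "Gr q = free_ring Quot (rel_ideal q)"

definition cls :: "real \<Rightarrow> free_alg \<Rightarrow> free_alg set" where
  "cls q p = rel_ideal q +>\<^bsub>free_ring\<^esub> p"

definition \<Lambda> :: "real \<Rightarrow> pluecker \<Rightarrow> free_alg set" where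
  "\<Lambda> q g = cls q (gen g)"

text \<open>For \<open>q > 0\<close> the map \<open>free_star q\<close> permutes the cosets of \<open>rel_ideal q\<close>.\<close>

definition Gr_star :: "real \<Rightarrow> free_alg set \<Rightarrow> free_alg set" where
  "Gr_star q F = free_star q ` F"

definition Gr_degree :: "real \<Rightarrow> nat \<Rightarrow> free_alg set set" where
  "Gr_degree q n = cls q ` {p. \<forall>w\<in>Poly_Mapping.keys p. length (letters w) = n}"

definition Gr_wt :: "real \<Rightarrow> int \<times> int \<Rightarrow> free_alg set set" where
  "Gr_wt q v = cls q ` {p. \<forall>w\<in>Poly_Mapping.keys p. word_weight w = v}"


subsection \<open>The localization at $\Lambda^{(12)}$ and $\Lambda^{(34)}$\<close>

definition denominators :: "real \<Rightarrow> free_alg set set" where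
  "denominators q =
    {\<Lambda> q P12 [^]\<^bsub>Gr q\<^esub> (m :: nat) \<otimes>\<^bsub>Gr q\<^esub> \<Lambda> q P34 [^]\<^bsub>Gr q\<^esub> (n :: nat) | m n. True}"

type_synonym loc = "(free_alg set \<times> free_alg set) set"

definition Gr_frac :: "real \<Rightarrow> free_alg set \<Rightarrow> free_alg set \<Rightarrow> loc" where
  "Gr_frac q = ore_frac (Gr q) (denominators q)"

definition emb :: "real \<Rightarrow> free_alg set \<Rightarrow> loc" where
  "emb q a = Gr_frac q a \<one>\<^bsub>Gr q\<^esub>"

definition loc_ring :: "real \<Rightarrow> loc ring" where
  "loc_ring q = ore_localization (Gr q) (denominators q)"

text \<open>
  The involution is the one forced by $(a s^{-1})^\dagger = (s^\dagger)^{-1} a^\dagger$; a fraction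
  $a s^{-1}$ with \<open>a\<close> and \<open>s\<close> homogeneous has the difference of their weights.
\<close>

definition Gr_loc :: "real \<Rightarrow> loc star_comodule" where
  "Gr_loc q =
    \<lparr>carrier = carrier (loc_ring q),
     monoid.mult = monoid.mult (loc_ring q),
     one = one (loc_ring q),
     ring.zero = ring.zero (loc_ring q),
     add = add (loc_ring q),
     module.smult = (\<lambda>c F. emb q (cls q (const c)) \<otimes>\<^bsub>loc_ring q\<^esub> F),
     star = (\<lambda>F. THE G. \<forall>(a, s)\<in>F.
       G = inv\<^bsub>loc_ring q\<^esub> (emb q (Gr_star q s)) \<otimes>\<^bsub>loc_ring q\<^esub> emb q (Gr_star q a)),
     wt = (\<lambda>w. {Gr_frac q a s | a s u v.
       a \<in> Gr_wt q u \<and> s \<in> denominators q \<and> s \<in> Gr_wt q v \<and> w = u - v})\<rparr>"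

definition generated_subalgebra :: "real \<Rightarrow> loc set \<Rightarrow> loc star_comodule" where
  "generated_subalgebra q H =
    (Gr_loc q)\<lparr>carrier := generate_ring (Gr_loc q) H,
      wt := (\<lambda>w. wt (Gr_loc q) w \<inter> generate_ring (Gr_loc q) H)\<rparr>"


subsection \<open>The two affine charts and their overlaps\<close>

text \<open>
  The degree-zero parts of the right localization at $\Lambda^{(34)}$ and of the left
  localization at $\Lambda^{(12)}$, as subalgebras of the localization at both.  They contain
  the scalars, so that the subrings generated below are subalgebras.
\<close>

definition R4 :: "real \<Rightarrow> loc set" where
  "R4 q = {Gr_frac q a (\<Lambda> q P34 [^]\<^bsub>Gr q\<^esub> n) | a n. a \<in> Gr_degree q n}"

definition R4_tilde :: "real \<Rightarrow> loc set" where
  "R4_tilde q =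
    {inv\<^bsub>Gr_loc q\<^esub> (emb q (\<Lambda> q P12 [^]\<^bsub>Gr q\<^esub> n)) \<otimes>\<^bsub>Gr_loc q\<^esub> emb q a | a n. a \<in> Gr_degree q n}"

definition rho :: "real \<Rightarrow> loc" where
  "rho q = complex_of_real q \<odot>\<^bsub>Gr_loc q\<^esub>
    (emb q (\<Lambda> q P12) \<otimes>\<^bsub>Gr_loc q\<^esub> inv\<^bsub>Gr_loc q\<^esub> (emb q (\<Lambda> q P34)))"

definition rho_tilde :: "real \<Rightarrow> loc" where
  "rho_tilde q = complex_of_real q \<odot>\<^bsub>Gr_loc q\<^esub>
    (inv\<^bsub>Gr_loc q\<^esub> (emb q (\<Lambda> q P12)) \<otimes>\<^bsub>Gr_loc q\<^esub> emb q (\<Lambda> q P34))"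

definition R4_adjoin_rho_tilde :: "real \<Rightarrow> loc star_comodule" where
  "R4_adjoin_rho_tilde q = generated_subalgebra q (insert (rho_tilde q) (R4 q))"

definition rho_adjoin_R4_tilde :: "real \<Rightarrow> loc star_comodule" where
  "rho_adjoin_R4_tilde q = generated_subalgebra q (insert (rho q) (R4_tilde q))"

end

theory Submission
  imports Defs
begin

text \<open>
  Both algebras are equal, as subsets of the localization at $\Lambda^{(12)}$ and $\Lambda^{(34)}$,
  to its subalgebra of degree zero: multiplying a fraction with denominator
  $(\Lambda^{(12)})^m (\Lambda^{(34)})^n$ by powers of $\tilde\rho$ or of $\rho$ moves the whole
  denominator to $\Lambda^{(34)}$ or to $\Lambda^{(12)}$.  So the identity is the isomorphism, and
  the work lies in showing that this subalgebra is a comodule star-algebra.  No domain property is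
  needed for that: $\Lambda^{(12)}$ and $\Lambda^{(34)}$ commute with every element homogeneous
  for the torus weight up to a nonzero scalar, so $s x = 0$ implies $x s = 0$ for each denominator
  $s$, and this suffices for the Ore localization, its involution and its grading.
\<close>

subsection \<open>Localization at a normal commutative set\<close>

text \<open>The obstacle is \<open>gen P12\<close>. Modulo the relations \<open>gen P34\<close> is
  central, but moving \<open>gen P12\<close> to the left of a word costs a power of \<open>q\<close>
  that depends on the weight of the word, so \<open>gen P12\<close> is only normal. Two properties
  of this twist carry the proof. It acts diagonally on words, so it creates no new words, and both
  the length and the weight of a numerator survive each exchange of left and right fractions. On a
  single weight it is a nonzero scalar; since all relations are weight homogeneous, the ideal is
  graded, and a condition such as \<open>gen P12 * p \<in> rel_ideal q\<close> splits into weight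
  components, on which the twist is harmless. The same splitting gives uniqueness of the weight
  decomposition of a fraction. On the abstract side, \<open>ore_localization\<close> takes unions
  over all representatives and all Ore completions, with cofactors that lie in \<open>R\<close>
  only. The axioms allow zero divisors in \<open>S\<close>, so every cancellation of
  \<open>s\<close> on the left is replaced by a multiplication by \<open>s\<close> on the right,
  which the expansion of fractions absorbs.\<close>

lemma Union_eq_constant:
  assumes "A \<in> \<A>" "\<And>B. B \<in> \<A> \<Longrightarrow> B = A"
  shows "\<Union>\<A> = A"
  using assms by blast

text \<open>\<open>normal\<close> is the right Ore condition with the denominator kept: formally
  s^{-1} a = b s^{-1}. Likewise \<open>reversible\<close> is right reversibility with the same
  \<open>s\<close> on both sides. Commutativity of \<open>S\<close> makes plain products serve as
  common denominators.\<close>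

locale normal_denominators = ring R for R (structure) +
  fixes S :: "'a set"
  assumes S_carrier: "S \<subseteq> carrier R"
    and S_one: "\<one> \<in> S"
    and S_mult: "\<lbrakk>s \<in> S; t \<in> S\<rbrakk> \<Longrightarrow> s \<otimes> t \<in> S"
    and S_comm: "\<lbrakk>s \<in> S; t \<in> S\<rbrakk> \<Longrightarrow> s \<otimes> t = t \<otimes> s"
    and normal: "\<lbrakk>s \<in> S; a \<in> carrier R\<rbrakk> \<Longrightarrow> \<exists>b\<in>carrier R. a \<otimes> s = s \<otimes> b"
    and reversible: "\<lbrakk>s \<in> S; x \<in> carrier R; s \<otimes> x = \<zero>\<rbrakk> \<Longrightarrow> x \<otimes> s = \<zero>"
begin

abbreviation "fraction \<equiv> ore_frac R S"
abbreviation "L \<equiv> ore_localization R S"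

section \<open>Cancellation and equality of fractions\<close>

lemma S_in_carrier [simp]: "s \<in> S \<Longrightarrow> s \<in> carrier R"
  using S_carrier by blast

lemma S_lcomm: "\<lbrakk>s \<in> S; t \<in> S; x \<in> carrier R\<rbrakk> \<Longrightarrow> s \<otimes> (t \<otimes> x) = t \<otimes> (s \<otimes> x)"
  using S_comm by (simp add: m_assoc[symmetric])

lemmas S_ac = m_assoc S_comm S_lcomm

text \<open>\<open>reversible\<close> applied to the difference of \<open>x\<close> and
  \<open>y\<close>. This is the substitute for cancellation: the factor \<open>s\<close> is not
  removed but reappears on the right, where a denominator can absorb it.\<close>

lemma left_cancel_imp_right:
  assumes "s \<in> S" "x \<in> carrier R" "y \<in> carrier R" "s \<otimes> x = s \<otimes> y"
  shows "x \<otimes> s = y \<otimes> s"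
proof -
  have "s \<otimes> (x \<ominus> y) = \<zero>"
    using assms by (simp add: minus_eq r_distr r_minus r_neg)
  then have "(x \<ominus> y) \<otimes> s = \<zero>"
    using assms reversible by simp
  then have "x \<otimes> s \<ominus> y \<otimes> s = \<zero>"
    using assms by (simp add: minus_eq l_distr l_minus)
  then show ?thesis
    using assms by (simp add: r_right_minus_eq)
qed

text \<open>Put r = s u = t v. Formally u = s^{-1} r and v = t^{-1} r, and the two equations are
  these with denominators cleared; the surplus factors on the right come from
  \<open>left_cancel_imp_right\<close>. The point is that \<open>u\<close> and \<open>v\<close> are
  arbitrary elements of \<open>R\<close>, whereas the right-hand sides involve elements of
  \<open>S\<close> only.\<close>

lemma common_multiple_cancel:
  assumes "s \<in> S" "t \<in> S" "u \<in> carrier R" "v \<in> carrier R"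
    and eq: "s \<otimes> u = t \<otimes> v" and r: "s \<otimes> u \<in> S"
  shows "u \<otimes> (s \<otimes> (t \<otimes> (s \<otimes> t))) = t \<otimes> ((s \<otimes> u) \<otimes> (s \<otimes> t))"
    and "v \<otimes> (s \<otimes> (t \<otimes> (s \<otimes> t))) = s \<otimes> ((s \<otimes> u) \<otimes> (s \<otimes> t))"
proof -
  define r where "r = s \<otimes> u"
  have rS: "r \<in> S" using r r_def by simp
  have "s \<otimes> (u \<otimes> (s \<otimes> t)) = r \<otimes> (s \<otimes> t)"
    unfolding r_def using assms(1-4) by (simp add: m_assoc)
  also have "\<dots> = s \<otimes> (t \<otimes> r)"
    using assms(1,2) rS by (simp add: S_ac S_mult)
  finally have eq1: "s \<otimes> (u \<otimes> (s \<otimes> t)) = s \<otimes> (t \<otimes> r)" .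
  have "(u \<otimes> (s \<otimes> t)) \<otimes> s = (t \<otimes> r) \<otimes> s"
    by (rule left_cancel_imp_right[OF assms(1) _ _ eq1]) (use assms(1-4) rS in simp_all)
  then have "((u \<otimes> (s \<otimes> t)) \<otimes> s) \<otimes> t = ((t \<otimes> r) \<otimes> s) \<otimes> t" by simp
  then show "u \<otimes> (s \<otimes> (t \<otimes> (s \<otimes> t))) = t \<otimes> ((s \<otimes> u) \<otimes> (s \<otimes> t))"
    unfolding r_def[symmetric] using assms(1-4) rS by (simp add: m_assoc)
  have "t \<otimes> (v \<otimes> (s \<otimes> t)) = r \<otimes> (s \<otimes> t)"
    unfolding r_def eq using assms(1-4) by (simp add: m_assoc)
  also have "\<dots> = t \<otimes> (s \<otimes> r)"
    using assms(1,2) rS by (simp add: S_ac S_mult)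
  finally have eq2: "t \<otimes> (v \<otimes> (s \<otimes> t)) = t \<otimes> (s \<otimes> r)" .
  have "(v \<otimes> (s \<otimes> t)) \<otimes> t = (s \<otimes> r) \<otimes> t"
    by (rule left_cancel_imp_right[OF assms(2) _ _ eq2]) (use assms(1-4) rS in simp_all)
  then have "((v \<otimes> (s \<otimes> t)) \<otimes> t) \<otimes> s = ((s \<otimes> r) \<otimes> t) \<otimes> s" by simp
  then have "v \<otimes> (s \<otimes> (t \<otimes> (t \<otimes> s))) = s \<otimes> (r \<otimes> (t \<otimes> s))"
    using assms(1-4) rS by (simp add: m_assoc)
  moreover have "t \<otimes> (t \<otimes> s) = t \<otimes> (s \<otimes> t)" "t \<otimes> s = s \<otimes> t" using assms(1,2) S_comm by metis+
  ultimately show "v \<otimes> (s \<otimes> (t \<otimes> (s \<otimes> t))) = s \<otimes> ((s \<otimes> u) \<otimes> (s \<otimes> t))"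
    unfolding r_def[symmetric] by simp
qed

text \<open>Since \<open>S\<close> is commutative, \<open>t \<otimes> w\<close> and
  \<open>s \<otimes> w\<close> are admissible cofactors, which gives one direction; for the other,
  arbitrary cofactors are turned into this form by \<open>common_multiple_cancel\<close>.\<close>

lemma ore_rel_iff:
  "((a, s), (b, t)) \<in> ore_rel R S \<longleftrightarrow>
    a \<in> carrier R \<and> b \<in> carrier R \<and> s \<in> S \<and> t \<in> S \<and> (\<exists>w\<in>S. a \<otimes> (t \<otimes> w) = b \<otimes> (s \<otimes> w))"
proof (intro iffI)
  assume L: "((a, s), (b, t)) \<in> ore_rel R S"
  then obtain u v where *: "a \<in> carrier R" "b \<in> carrier R" "s \<in> S" "t \<in> S"
    "u \<in> carrier R" "v \<in> carrier R" "s \<otimes> u = t \<otimes> v" "s \<otimes> u \<in> S" "a \<otimes> u = b \<otimes> v"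
    unfolding ore_rel_def by auto
  \<comment> \<open>Chosen so that \<open>t \<otimes> w\<close> and \<open>s \<otimes> w\<close> are
    \<open>u\<close> and \<open>v\<close> multiplied on the right by one and the same element of
    \<open>S\<close>.\<close>
  define w where "w = (s \<otimes> u) \<otimes> (s \<otimes> t)"
  have "w \<in> S" using * by (simp add: w_def S_mult)
  have "a \<otimes> (t \<otimes> w) = (a \<otimes> u) \<otimes> (s \<otimes> (t \<otimes> (s \<otimes> t)))"
    unfolding w_def common_multiple_cancel(1)[OF *(3-8), symmetric] using *(1-6) by (simp add: m_assoc)
  also have "\<dots> = (b \<otimes> v) \<otimes> (s \<otimes> (t \<otimes> (s \<otimes> t)))" using * by simp
  also have "\<dots> = b \<otimes> (s \<otimes> w)"
    unfolding w_def common_multiple_cancel(2)[OF *(3-8), symmetric] using *(1-6) by (simp add: m_assoc)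
  finally show "a \<in> carrier R \<and> b \<in> carrier R \<and> s \<in> S \<and> t \<in> S \<and> (\<exists>w\<in>S. a \<otimes> (t \<otimes> w) = b \<otimes> (s \<otimes> w))"
    using * \<open>w \<in> S\<close> by blast
next
  assume "a \<in> carrier R \<and> b \<in> carrier R \<and> s \<in> S \<and> t \<in> S \<and> (\<exists>w\<in>S. a \<otimes> (t \<otimes> w) = b \<otimes> (s \<otimes> w))"
  then obtain w where *: "a \<in> carrier R" "b \<in> carrier R" "s \<in> S" "t \<in> S" "w \<in> S"
    "a \<otimes> (t \<otimes> w) = b \<otimes> (s \<otimes> w)" by blast
  then have "s \<otimes> (t \<otimes> w) = t \<otimes> (s \<otimes> w)" "s \<otimes> (t \<otimes> w) \<in> S" "t \<otimes> w \<in> carrier R" "s \<otimes> w \<in> carrier R"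
    by (simp_all add: S_lcomm S_mult)
  with * show "((a, s), (b, t)) \<in> ore_rel R S"
    unfolding ore_rel_def by blast
qed

lemma equiv_ore_rel: "equiv (carrier R \<times> S) (ore_rel R S)"
proof (rule equivI)
  show "refl_on (carrier R \<times> S) (ore_rel R S)"
    by (rule refl_onI) (use S_one in \<open>auto simp: ore_rel_iff\<close>)
  show "sym (ore_rel R S)"
    by (rule symI) (clarsimp simp: ore_rel_iff, metis)
  show "ore_rel R S \<subseteq> (carrier R \<times> S) \<times> (carrier R \<times> S)"
    by (auto simp: ore_rel_iff)
  show "trans (ore_rel R S)"
  proof (rule transI, clarify)
    fix a s b t c r
    assume "((a, s), (b, t)) \<in> ore_rel R S" "((b, t), (c, r)) \<in> ore_rel R S"
    then obtain w w' where *: "a \<in> carrier R" "b \<in> carrier R" "c \<in> carrier R" "s \<in> S" "t \<in> S" "r \<in> S"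
      "w \<in> S" "w' \<in> S" "a \<otimes> (t \<otimes> w) = b \<otimes> (s \<otimes> w)" "b \<otimes> (r \<otimes> w') = c \<otimes> (t \<otimes> w')"
      by (auto simp: ore_rel_iff)
    \<comment> \<open>The witness is \<open>t \<otimes> (w \<otimes> w')\<close>: it contains the
      factors that both hypotheses need, and all of them commute.\<close>
    have "a \<otimes> (r \<otimes> (t \<otimes> (w \<otimes> w'))) = (a \<otimes> (t \<otimes> w)) \<otimes> (r \<otimes> w')"
      using *(1-8) by (simp add: S_ac S_mult)
    also have "\<dots> = (b \<otimes> (r \<otimes> w')) \<otimes> (s \<otimes> w)"
      unfolding *(9) using *(1-8) by (simp add: S_ac S_mult)
    also have "\<dots> = c \<otimes> (s \<otimes> (t \<otimes> (w \<otimes> w')))"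
      unfolding *(10) using *(1-8) by (simp add: S_ac S_mult)
    finally show "((a, s), (c, r)) \<in> ore_rel R S"
      unfolding ore_rel_iff using * S_mult by blast
  qed
qed

lemma fraction_eq_iff:
  assumes "a \<in> carrier R" "s \<in> S" "b \<in> carrier R" "t \<in> S"
  shows "fraction a s = fraction b t \<longleftrightarrow> (\<exists>w\<in>S. a \<otimes> (t \<otimes> w) = b \<otimes> (s \<otimes> w))"
  unfolding ore_frac_def using assms
  by (subst eq_equiv_class_iff[OF equiv_ore_rel]) (auto simp: ore_rel_iff)

lemma fraction_expand:
  assumes "a \<in> carrier R" "s \<in> S" "u \<in> S"
  shows "fraction (a \<otimes> u) (s \<otimes> u) = fraction a s"
  by (subst fraction_eq_iff) (use assms S_one in \<open>auto simp: S_mult S_ac intro!: bexI[of _ \<one>]\<close>)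

lemma mem_fraction_iff:
  assumes "a \<in> carrier R" "s \<in> S"
  shows "(b, t) \<in> fraction a s \<longleftrightarrow> b \<in> carrier R \<and> t \<in> S \<and> fraction b t = fraction a s"
proof
  assume "(b, t) \<in> fraction a s"
  then have "((a, s), (b, t)) \<in> ore_rel R S" by (simp add: ore_frac_def)
  then show "b \<in> carrier R \<and> t \<in> S \<and> fraction b t = fraction a s"
    using equiv_class_eq[OF equiv_ore_rel, of "(a, s)" "(b, t)"] ore_rel_iff unfolding ore_frac_def by blast
next
  assume *: "b \<in> carrier R \<and> t \<in> S \<and> fraction b t = fraction a s"
  then have "(b, t) \<in> fraction b t"
    unfolding ore_frac_def using equiv_class_self[OF equiv_ore_rel, of "(b, t)"] by simp
  with * show "(b, t) \<in> fraction a s" by metis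
qed

section \<open>The carrier and products of fractions\<close>

lemma carrier_localization: "carrier L = {fraction a s |a s. a \<in> carrier R \<and> s \<in> S}"
  by (auto simp: ore_localization_def quotient_def ore_frac_def)

lemma fraction_closed [simp]: "\<lbrakk>a \<in> carrier R; s \<in> S\<rbrakk> \<Longrightarrow> fraction a s \<in> carrier L"
  using carrier_localization by blast

lemma localizationE:
  assumes "x \<in> carrier L"
  obtains a s where "a \<in> carrier R" "s \<in> S" "x = fraction a s"
  using assms carrier_localization by blast

text \<open>Equality of fractions is generated by expansion: a/s and b/t expand to the same pair,
  because a t w = b s w and s t w = t s w. Well-definedness of an operation is therefore tested on
  expansions alone.\<close>

lemma fraction_invariant:
  assumes inv: "\<And>a s u. \<lbrakk>a \<in> carrier R; s \<in> S; u \<in> S\<rbrakk> \<Longrightarrow> P (a \<otimes> u) (s \<otimes> u) = P a s"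
    and *: "a \<in> carrier R" "s \<in> S" "b \<in> carrier R" "t \<in> S" "fraction a s = fraction b t"
  shows "P a s = P b t"
proof -
  obtain w where w: "w \<in> S" "a \<otimes> (t \<otimes> w) = b \<otimes> (s \<otimes> w)"
    using * fraction_eq_iff by blast
  have "P a s = P (a \<otimes> (t \<otimes> w)) (s \<otimes> (t \<otimes> w))"
    using inv[OF *(1,2), of "t \<otimes> w"] *(4) w(1) S_mult by simp
  also have "\<dots> = P (b \<otimes> (s \<otimes> w)) (t \<otimes> (s \<otimes> w))"
    unfolding w(2) using *(2,4) w(1) by (simp add: S_lcomm)
  also have "\<dots> = P b t"
    using inv[OF *(3,4), of "s \<otimes> w"] *(2) w(1) S_mult by simp
  finally show ?thesis .
qed

text \<open>Both c u^{-1} and c' u'^{-1} stand for s^{-1} b. Indeed s c u' and s c' u both equal b u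
  u', and \<open>s\<close> is then moved to the right.\<close>

lemma twist_unique:
  assumes "a \<in> carrier R" "s \<in> S" "t \<in> S" "b \<in> carrier R"
    and "c \<in> carrier R" "u \<in> S" "b \<otimes> u = s \<otimes> c"
    and "c' \<in> carrier R" "u' \<in> S" "b \<otimes> u' = s \<otimes> c'"
  shows "fraction (a \<otimes> c) (t \<otimes> u) = fraction (a \<otimes> c') (t \<otimes> u')"
proof -
  have "s \<otimes> (c \<otimes> u') = (b \<otimes> u) \<otimes> u'" using assms by (simp add: m_assoc)
  also have "\<dots> = (b \<otimes> u') \<otimes> u" using assms(1-6,8,9) by (simp add: S_ac)
  also have "\<dots> = s \<otimes> (c' \<otimes> u)" using assms by (simp add: m_assoc)
  finally have *: "s \<otimes> (c \<otimes> u') = s \<otimes> (c' \<otimes> u)" .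
  have eq: "c \<otimes> u' \<otimes> s = c' \<otimes> u \<otimes> s"
    by (rule left_cancel_imp_right[OF assms(2) _ _ *]) (use assms(1-6,8,9) in simp_all)
  have "a \<otimes> c \<otimes> (t \<otimes> u' \<otimes> s) = a \<otimes> (c \<otimes> u' \<otimes> s) \<otimes> t"
    using assms(1-6,8,9) by (simp add: S_ac)
  also have "\<dots> = a \<otimes> c' \<otimes> (t \<otimes> u \<otimes> s)"
    unfolding eq using assms(1-6,8,9) by (simp add: S_ac)
  finally show ?thesis
    using assms by (subst fraction_eq_iff) (auto simp: S_mult m_assoc intro!: bexI[of _ s])
qed

text \<open>The completion u = s supplied by \<open>normal\<close> is singled out here. As a
  function of the pairs, the product can be fed to \<open>fraction_invariant\<close>, one factor at
  a time.\<close>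

definition fraction_mult :: "'a \<Rightarrow> 'a \<Rightarrow> 'a \<Rightarrow> 'a \<Rightarrow> ('a \<times> 'a) set" where
  "fraction_mult a s b t = fraction (a \<otimes> (SOME c. c \<in> carrier R \<and> b \<otimes> s = s \<otimes> c)) (t \<otimes> s)"

lemma fraction_mult_eq:
  assumes "a \<in> carrier R" "s \<in> S" "t \<in> S" "b \<in> carrier R" "c \<in> carrier R" "u \<in> S" "b \<otimes> u = s \<otimes> c"
  shows "fraction_mult a s b t = fraction (a \<otimes> c) (t \<otimes> u)"
proof -
  define c' where "c' = (SOME c. c \<in> carrier R \<and> b \<otimes> s = s \<otimes> c)"
  have "\<exists>c. c \<in> carrier R \<and> b \<otimes> s = s \<otimes> c" using normal assms by blast
  from someI_ex[OF this] have "c' \<in> carrier R" "b \<otimes> s = s \<otimes> c'"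
    by (simp_all add: c'_def)
  then show ?thesis
    unfolding fraction_mult_def c'_def[symmetric] using assms by (intro twist_unique[of a s t b]) auto
qed

lemma fraction_mult_left:
  assumes "a \<in> carrier R" "s \<in> S" "t \<in> S" "b \<in> carrier R" "u \<in> S"
  shows "fraction_mult (a \<otimes> u) (s \<otimes> u) b t = fraction_mult a s b t"
proof -
  obtain c where c: "c \<in> carrier R" "b \<otimes> (s \<otimes> u) = (s \<otimes> u) \<otimes> c"
    using normal[of "s \<otimes> u" b] assms S_mult by auto
  have "fraction_mult (a \<otimes> u) (s \<otimes> u) b t = fraction (a \<otimes> u \<otimes> c) (t \<otimes> (s \<otimes> u))"
    using assms c by (intro fraction_mult_eq) (auto simp: S_mult)
  also have "\<dots> = fraction (a \<otimes> (u \<otimes> c)) (t \<otimes> (s \<otimes> u))"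
    using assms c by (simp add: m_assoc)
  \<comment> \<open>The completion b (s u) = (s u) c for the expanded pair is also one for
    \<open>s\<close> itself, with cofactor u c.\<close>
  also have "\<dots> = fraction_mult a s b t"
    using assms c by (intro fraction_mult_eq[symmetric]) (auto simp: S_mult m_assoc)
  finally show ?thesis .
qed

lemma fraction_mult_right:
  assumes "a \<in> carrier R" "s \<in> S" "t \<in> S" "b \<in> carrier R" "u \<in> S"
  shows "fraction_mult a s (b \<otimes> u) (t \<otimes> u) = fraction_mult a s b t"
proof -
  obtain c where c: "c \<in> carrier R" "b \<otimes> s = s \<otimes> c"
    using normal assms by blast
  have "b \<otimes> u \<otimes> s = (b \<otimes> s) \<otimes> u" using assms by (simp add: S_ac)
  also have "\<dots> = s \<otimes> (c \<otimes> u)" using assms c by (simp add: m_assoc)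
  finally have "fraction_mult a s (b \<otimes> u) (t \<otimes> u) = fraction (a \<otimes> (c \<otimes> u)) (t \<otimes> u \<otimes> s)"
    using assms c by (intro fraction_mult_eq) (auto simp: S_mult)
  also have "\<dots> = fraction ((a \<otimes> c) \<otimes> u) ((t \<otimes> s) \<otimes> u)"
    using assms c(1) by (simp add: S_ac)
  also have "\<dots> = fraction_mult a s b t"
    using assms c by (simp add: fraction_expand S_mult fraction_mult_eq[of a s t b c s])
  finally show ?thesis .
qed

lemma localization_mult:
  assumes "a \<in> carrier R" "s \<in> S" "t \<in> S" "b \<in> carrier R" "c \<in> carrier R" "u \<in> S" "b \<otimes> u = s \<otimes> c"
  shows "fraction a s \<otimes>\<^bsub>L\<^esub> fraction b t = fraction (a \<otimes> c) (t \<otimes> u)"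
proof -
  have fractions: "fraction (a' \<otimes> c') (t' \<otimes> u') = fraction_mult a s b t"
    if "(a', s') \<in> fraction a s" "(b', t') \<in> fraction b t" "c' \<in> carrier R" "u' \<in> S" "b' \<otimes> u' = s' \<otimes> c'"
    for a' s' b' t' c' u'
  proof -
    have *: "a' \<in> carrier R" "s' \<in> S" "fraction a' s' = fraction a s" "b' \<in> carrier R" "t' \<in> S" "fraction b' t' = fraction b t"
      using that assms by (simp_all add: mem_fraction_iff)
    have "fraction (a' \<otimes> c') (t' \<otimes> u') = fraction_mult a' s' b' t'"
      using that * by (simp add: fraction_mult_eq)
    also have "\<dots> = fraction_mult a s b' t'"
      by (rule fraction_invariant[of "\<lambda>x y. fraction_mult x y b' t'"]) (use * assms in \<open>auto simp: fraction_mult_left\<close>)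
    also have "\<dots> = fraction_mult a s b t"
      by (rule fraction_invariant[of "\<lambda>x y. fraction_mult a s x y"]) (use * assms in \<open>auto simp: fraction_mult_right\<close>)
    finally show ?thesis .
  qed
  have "(a, s) \<in> fraction a s" "(b, t) \<in> fraction b t" using assms mem_fraction_iff by auto
  with assms have mem: "\<exists>a' s' b' t' c' u'. fraction (a \<otimes> c) (t \<otimes> u) = fraction (a' \<otimes> c') (t' \<otimes> u') \<and>
      (a', s') \<in> fraction a s \<and> (b', t') \<in> fraction b t \<and> c' \<in> carrier R \<and> u' \<in> S \<and> b' \<otimes> u' = s' \<otimes> c'"
    by blast
  \<comment> \<open>The product is by definition the union over all choices: \<open>mem\<close>
    exhibits one member, and \<open>fractions\<close> identifies every other one with it.\<close>
  show ?thesis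
    unfolding ore_localization_def monoid.simps
  proof (rule Union_eq_constant, goal_cases)
    case 1
    then show ?case using mem by (simp only: mem_Collect_eq)
  next
    case (2 B)
    then show ?case using fractions fraction_mult_eq[OF assms] by (auto simp only: mem_Collect_eq)
  qed
qed

section \<open>Sums of fractions\<close>

definition fraction_add :: "'a \<Rightarrow> 'a \<Rightarrow> 'a \<Rightarrow> 'a \<Rightarrow> ('a \<times> 'a) set" where
  "fraction_add a s b t = fraction (a \<otimes> t \<oplus> b \<otimes> s) (s \<otimes> t)"

lemma fraction_add_left:
  assumes "a \<in> carrier R" "s \<in> S" "t \<in> S" "b \<in> carrier R" "u \<in> S"
  shows "fraction_add (a \<otimes> u) (s \<otimes> u) b t = fraction_add a s b t"
proof -
  have "fraction_add (a \<otimes> u) (s \<otimes> u) b t = fraction ((a \<otimes> t \<oplus> b \<otimes> s) \<otimes> u) (s \<otimes> t \<otimes> u)"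
    unfolding fraction_add_def using assms by (simp add: S_ac l_distr)
  then show ?thesis using assms by (simp add: fraction_expand S_mult fraction_add_def)
qed

lemma fraction_add_right:
  assumes "a \<in> carrier R" "s \<in> S" "t \<in> S" "b \<in> carrier R" "u \<in> S"
  shows "fraction_add a s (b \<otimes> u) (t \<otimes> u) = fraction_add a s b t"
proof -
  have "fraction_add a s (b \<otimes> u) (t \<otimes> u) = fraction ((a \<otimes> t \<oplus> b \<otimes> s) \<otimes> u) (s \<otimes> t \<otimes> u)"
    unfolding fraction_add_def using assms by (simp add: S_ac l_distr)
  then show ?thesis using assms by (simp add: fraction_expand S_mult fraction_add_def)
qed

text \<open>The common multiple s u may be much smaller than s t. After clearing with
  \<open>s \<otimes> t\<close>, both numerators become a t r s t + b s r s t with r = s u.\<close>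

lemma fraction_add_eq:
  assumes "a \<in> carrier R" "s \<in> S" "t \<in> S" "b \<in> carrier R" "u \<in> carrier R" "v \<in> carrier R"
    "s \<otimes> u = t \<otimes> v" "s \<otimes> u \<in> S"
  shows "fraction (a \<otimes> u \<oplus> b \<otimes> v) (s \<otimes> u) = fraction_add a s b t"
proof -
  define r where "r = s \<otimes> u"
  have rS: "r \<in> S" using assms r_def by simp
  have eq: "u \<otimes> (s \<otimes> (t \<otimes> (s \<otimes> t))) = t \<otimes> (r \<otimes> (s \<otimes> t))"
    "v \<otimes> (s \<otimes> (t \<otimes> (s \<otimes> t))) = s \<otimes> (r \<otimes> (s \<otimes> t))"
    using common_multiple_cancel[of s t u v] assms r_def by simp_all
  have "(a \<otimes> u \<oplus> b \<otimes> v) \<otimes> (s \<otimes> t \<otimes> (s \<otimes> t)) = (a \<otimes> t \<oplus> b \<otimes> s) \<otimes> (r \<otimes> (s \<otimes> t))"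
    using assms(1-6) rS by (simp add: l_distr m_assoc eq)
  then show ?thesis
    unfolding fraction_add_def r_def[symmetric] using assms(1-6) rS
    by (subst fraction_eq_iff) (auto simp: S_mult intro!: bexI[of _ "s \<otimes> t"])
qed

lemma localization_add:
  assumes "a \<in> carrier R" "s \<in> S" "t \<in> S" "b \<in> carrier R"
  shows "fraction a s \<oplus>\<^bsub>L\<^esub> fraction b t = fraction (a \<otimes> t \<oplus> b \<otimes> s) (s \<otimes> t)"
proof -
  have fractions: "fraction (a' \<otimes> u \<oplus> b' \<otimes> v) (s' \<otimes> u) = fraction_add a s b t"
    if "(a', s') \<in> fraction a s" "(b', t') \<in> fraction b t" "u \<in> carrier R" "v \<in> carrier R"
      "s' \<otimes> u = t' \<otimes> v" "s' \<otimes> u \<in> S" for a' s' b' t' u v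
  proof -
    have *: "a' \<in> carrier R" "s' \<in> S" "fraction a' s' = fraction a s" "b' \<in> carrier R" "t' \<in> S" "fraction b' t' = fraction b t"
      using that assms by (simp_all add: mem_fraction_iff)
    have "fraction (a' \<otimes> u \<oplus> b' \<otimes> v) (s' \<otimes> u) = fraction_add a' s' b' t'"
      by (rule fraction_add_eq) (fact * that)+
    also have "\<dots> = fraction_add a s b' t'"
      by (rule fraction_invariant[of "\<lambda>x y. fraction_add x y b' t'"]) (use * assms in \<open>auto simp: fraction_add_left\<close>)
    also have "\<dots> = fraction_add a s b t"
      by (rule fraction_invariant[of "\<lambda>x y. fraction_add a s x y"]) (use * assms in \<open>auto simp: fraction_add_right\<close>)
    finally show ?thesis .
  qed
  have "(a, s) \<in> fraction a s" "(b, t) \<in> fraction b t" using assms mem_fraction_iff by auto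
  moreover have "s \<otimes> t = t \<otimes> s" "s \<otimes> t \<in> S" using assms S_comm S_mult by auto
  moreover have "t \<in> carrier R" "s \<in> carrier R" using assms by simp_all
  ultimately have mem: "\<exists>a' s' b' t' u v. fraction (a \<otimes> t \<oplus> b \<otimes> s) (s \<otimes> t) = fraction (a' \<otimes> u \<oplus> b' \<otimes> v) (s' \<otimes> u) \<and>
      (a', s') \<in> fraction a s \<and> (b', t') \<in> fraction b t \<and> u \<in> carrier R \<and> v \<in> carrier R \<and>
      s' \<otimes> u = t' \<otimes> v \<and> s' \<otimes> u \<in> S"
    by blast
  show ?thesis
    unfolding ore_localization_def ring.simps
  proof (rule Union_eq_constant, goal_cases)
    case 1
    then show ?case using mem by (simp only: mem_Collect_eq)
  next
    case (2 B)
    then show ?case using fractions by (auto simp only: mem_Collect_eq fraction_add_def)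
  qed
qed

lemma localization_add_same:
  assumes "a \<in> carrier R" "s \<in> S" "b \<in> carrier R"
  shows "fraction a s \<oplus>\<^bsub>L\<^esub> fraction b s = fraction (a \<oplus> b) s"
proof -
  have "fraction a s \<oplus>\<^bsub>L\<^esub> fraction b s = fraction ((a \<oplus> b) \<otimes> s) (s \<otimes> s)"
    using assms by (simp add: localization_add l_distr)
  then show ?thesis using assms by (simp add: fraction_expand)
qed

lemma localization_one: "\<one>\<^bsub>L\<^esub> = fraction \<one> \<one>"
  and localization_zero: "\<zero>\<^bsub>L\<^esub> = fraction \<zero> \<one>"
  by (simp_all add: ore_localization_def)

lemma fraction_same: "s \<in> S \<Longrightarrow> fraction s s = \<one>\<^bsub>L\<^esub>"
  using fraction_expand[of \<one> \<one> s] S_one by (simp add: localization_one)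

lemma fraction_zero: "s \<in> S \<Longrightarrow> fraction \<zero> s = \<zero>\<^bsub>L\<^esub>"
  using fraction_expand[of \<zero> \<one> s] S_one by (simp add: localization_zero)

section \<open>Common denominators and the ring axioms\<close>

lemma common_denominator2:
  assumes "x \<in> carrier L" "y \<in> carrier L"
  obtains a b s where "a \<in> carrier R" "b \<in> carrier R" "s \<in> S" "x = fraction a s" "y = fraction b s"
proof -
  obtain a s b t where *: "a \<in> carrier R" "s \<in> S" "x = fraction a s" "b \<in> carrier R" "t \<in> S" "y = fraction b t"
    using assms by (metis localizationE)
  have "x = fraction (a \<otimes> t) (s \<otimes> t)" "y = fraction (b \<otimes> s) (t \<otimes> s)"
    using * by (simp_all add: fraction_expand)
  moreover have "t \<otimes> s = s \<otimes> t" using * S_comm by simp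
  ultimately show ?thesis using that[of "a \<otimes> t" "b \<otimes> s" "s \<otimes> t"] * by (simp add: S_mult)
qed

lemma common_denominator3:
  assumes "x \<in> carrier L" "y \<in> carrier L" "z \<in> carrier L"
  obtains a b c s where "a \<in> carrier R" "b \<in> carrier R" "c \<in> carrier R" "s \<in> S"
    "x = fraction a s" "y = fraction b s" "z = fraction c s"
proof -
  obtain a b s where *: "a \<in> carrier R" "b \<in> carrier R" "s \<in> S" "x = fraction a s" "y = fraction b s"
    using common_denominator2 assms by metis
  obtain c t where **: "c \<in> carrier R" "t \<in> S" "z = fraction c t"
    using localizationE assms by metis
  have "x = fraction (a \<otimes> t) (s \<otimes> t)" "y = fraction (b \<otimes> t) (s \<otimes> t)" "z = fraction (c \<otimes> s) (t \<otimes> s)"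
    using * ** by (simp_all add: fraction_expand)
  moreover have "t \<otimes> s = s \<otimes> t" using * ** S_comm by simp
  ultimately show ?thesis using that[of "a \<otimes> t" "b \<otimes> t" "c \<otimes> s" "s \<otimes> t"] * ** by (simp add: S_mult)
qed

lemma localization_abelian_group: "abelian_group L"
proof (rule abelian_groupI)
  show "x \<oplus>\<^bsub>L\<^esub> y \<in> carrier L" if "x \<in> carrier L" "y \<in> carrier L" for x y
    using common_denominator2[OF that] by (metis fraction_closed localization_add_same add.m_closed)
  show "\<zero>\<^bsub>L\<^esub> \<in> carrier L" by (simp add: localization_zero S_one)
  show "x \<oplus>\<^bsub>L\<^esub> y \<oplus>\<^bsub>L\<^esub> z = x \<oplus>\<^bsub>L\<^esub> (y \<oplus>\<^bsub>L\<^esub> z)"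
    if xyz: "x \<in> carrier L" "y \<in> carrier L" "z \<in> carrier L" for x y z
    by (rule common_denominator3[OF xyz]) (simp add: localization_add_same a_assoc)
  show "x \<oplus>\<^bsub>L\<^esub> y = y \<oplus>\<^bsub>L\<^esub> x" if "x \<in> carrier L" "y \<in> carrier L" for x y
    by (rule common_denominator2[OF that]) (simp add: localization_add_same a_comm)
  show "\<zero>\<^bsub>L\<^esub> \<oplus>\<^bsub>L\<^esub> x = x" if x: "x \<in> carrier L" for x
    using x by (rule localizationE) (simp add: fraction_zero[symmetric] localization_add_same)
  show "\<exists>y\<in>carrier L. y \<oplus>\<^bsub>L\<^esub> x = \<zero>\<^bsub>L\<^esub>" if x: "x \<in> carrier L" for x
    using x
  proof (rule localizationE)
    fix a s assume *: "a \<in> carrier R" "s \<in> S" "x = fraction a s"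
    then have "fraction (\<ominus> a) s \<oplus>\<^bsub>L\<^esub> x = \<zero>\<^bsub>L\<^esub>"
      by (simp add: localization_add_same l_neg fraction_zero)
    with * show ?thesis by (intro bexI[of _ "fraction (\<ominus> a) s"]) simp_all
  qed
qed

lemma localization_monoid: "Group.monoid L"
proof (rule monoidI)
  show "\<one>\<^bsub>L\<^esub> \<in> carrier L" by (simp add: localization_one S_one)
  show "x \<otimes>\<^bsub>L\<^esub> y \<in> carrier L" if xy: "x \<in> carrier L" "y \<in> carrier L" for x y
  proof -
    obtain a s where a: "a \<in> carrier R" "s \<in> S" "x = fraction a s" using xy localizationE by metis
    obtain b t where b: "b \<in> carrier R" "t \<in> S" "y = fraction b t" using xy localizationE by metis
    obtain c where c: "c \<in> carrier R" "b \<otimes> s = s \<otimes> c" using normal a b by blast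
    show ?thesis using a b c by (simp add: localization_mult[of a s t b c s] S_mult)
  qed
  show "\<one>\<^bsub>L\<^esub> \<otimes>\<^bsub>L\<^esub> x = x" if x: "x \<in> carrier L" for x
    using x
  proof (rule localizationE)
    fix a s assume *: "a \<in> carrier R" "s \<in> S" "x = fraction a s"
    then show "\<one>\<^bsub>L\<^esub> \<otimes>\<^bsub>L\<^esub> x = x"
      using localization_mult[of \<one> \<one> s a a \<one>] S_one by (simp add: localization_one)
  qed
  show "x \<otimes>\<^bsub>L\<^esub> \<one>\<^bsub>L\<^esub> = x" if x: "x \<in> carrier L" for x
    using x
  proof (rule localizationE)
    fix a s assume *: "a \<in> carrier R" "s \<in> S" "x = fraction a s"
    then show "x \<otimes>\<^bsub>L\<^esub> \<one>\<^bsub>L\<^esub> = x"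
      using localization_mult[of a s \<one> \<one> \<one> s] S_one by (simp add: localization_one)
  qed
  show "x \<otimes>\<^bsub>L\<^esub> y \<otimes>\<^bsub>L\<^esub> z = x \<otimes>\<^bsub>L\<^esub> (y \<otimes>\<^bsub>L\<^esub> z)"
    if xyz: "x \<in> carrier L" "y \<in> carrier L" "z \<in> carrier L" for x y z
  proof -
    obtain a s where a: "a \<in> carrier R" "s \<in> S" "x = fraction a s" using xyz localizationE by metis
    obtain b t where b: "b \<in> carrier R" "t \<in> S" "y = fraction b t" using xyz localizationE by metis
    obtain c u where c: "c \<in> carrier R" "u \<in> S" "z = fraction c u" using xyz localizationE by metis
    \<comment> \<open>\<open>b'\<close> is \<open>b\<close> carried past \<open>s\<close>,
      \<open>e\<close> is \<open>c\<close> carried past \<open>t\<close>, and \<open>d\<close> is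
      \<open>e\<close> carried past \<open>s\<close>. Hence \<open>d\<close> is \<open>c\<close>
      carried past t s, and b' d is b e carried past \<open>s\<close>, so both bracketings give a b'
      d over u t s.\<close>
    obtain b' where b': "b' \<in> carrier R" "b \<otimes> s = s \<otimes> b'" using normal a b by blast
    obtain e where e: "e \<in> carrier R" "c \<otimes> t = t \<otimes> e" using normal c b by blast
    obtain d where d: "d \<in> carrier R" "e \<otimes> s = s \<otimes> d" using normal a e by blast
    have "c \<otimes> (t \<otimes> s) = (c \<otimes> t) \<otimes> s" using a b c by (simp add: m_assoc)
    also have "\<dots> = t \<otimes> (e \<otimes> s)" using a b e by (simp add: m_assoc)
    also have "\<dots> = (t \<otimes> s) \<otimes> d" unfolding d(2) using a b d(1) by (simp add: m_assoc)
    finally have 1: "c \<otimes> (t \<otimes> s) = (t \<otimes> s) \<otimes> d" .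
    have "(b \<otimes> e) \<otimes> s = b \<otimes> (e \<otimes> s)" using a b e by (simp add: m_assoc)
    also have "\<dots> = (b \<otimes> s) \<otimes> d" unfolding d(2) using a b d(1) by (simp add: m_assoc)
    also have "\<dots> = s \<otimes> (b' \<otimes> d)" unfolding b'(2) using a b' d(1) by (simp add: m_assoc)
    finally have 2: "(b \<otimes> e) \<otimes> s = s \<otimes> (b' \<otimes> d)" .
    have "x \<otimes>\<^bsub>L\<^esub> y \<otimes>\<^bsub>L\<^esub> z = fraction ((a \<otimes> b') \<otimes> d) (u \<otimes> (t \<otimes> s))"
      using a b c b' d(1) 1 by (simp add: localization_mult[of a s t b b' s] localization_mult[of _ "t \<otimes> s" u c d "t \<otimes> s"] S_mult)
    also have "\<dots> = fraction (a \<otimes> (b' \<otimes> d)) ((u \<otimes> t) \<otimes> s)"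
      using a b c b'(1) d(1) by (simp add: m_assoc)
    also have "\<dots> = x \<otimes>\<^bsub>L\<^esub> (y \<otimes>\<^bsub>L\<^esub> z)"
      using a b c b'(1) e d(1) 2
      by (simp add: localization_mult[of b t u c e t] localization_mult[of a s _ "b \<otimes> e" "b' \<otimes> d" s] S_mult)
    finally show ?thesis .
  qed
qed

lemma localization_ring: "ring L"
proof (rule ringI[OF localization_abelian_group localization_monoid])
  fix x y z assume xyz: "x \<in> carrier L" "y \<in> carrier L" "z \<in> carrier L"
  obtain a b s where a: "a \<in> carrier R" "b \<in> carrier R" "s \<in> S" "x = fraction a s" "y = fraction b s"
    using xyz common_denominator2 by metis
  obtain c t where c: "c \<in> carrier R" "t \<in> S" "z = fraction c t" using xyz localizationE by metis
  obtain c' where c': "c' \<in> carrier R" "c \<otimes> s = s \<otimes> c'" using normal a c by blast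
  show "(x \<oplus>\<^bsub>L\<^esub> y) \<otimes>\<^bsub>L\<^esub> z = x \<otimes>\<^bsub>L\<^esub> z \<oplus>\<^bsub>L\<^esub> y \<otimes>\<^bsub>L\<^esub> z"
    using a c c' by (simp add: localization_add_same localization_mult[of _ s t c c' s] S_mult l_distr)
  obtain a' where a': "a' \<in> carrier R" "a \<otimes> t = t \<otimes> a'" using normal a c by blast
  obtain b' where b': "b' \<in> carrier R" "b \<otimes> t = t \<otimes> b'" using normal a c by blast
  have "(a \<oplus> b) \<otimes> t = t \<otimes> (a' \<oplus> b')" using a a' b' c by (simp add: l_distr r_distr)
  then show "z \<otimes>\<^bsub>L\<^esub> (x \<oplus>\<^bsub>L\<^esub> y) = z \<otimes>\<^bsub>L\<^esub> x \<oplus>\<^bsub>L\<^esub> z \<otimes>\<^bsub>L\<^esub> y"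
    using a c a' b'
    by (simp add: localization_add_same localization_mult[of c t s a a' t] localization_mult[of c t s b b' t]
        localization_mult[of c t s "a \<oplus> b" "a' \<oplus> b'" t] S_mult r_distr)
qed

lemma localization_inv:
  assumes "s \<in> S"
  shows "inv\<^bsub>L\<^esub> (fraction s \<one>) = fraction \<one> s"
proof -
  interpret L: ring L by (rule localization_ring)
  have "fraction s \<one> \<otimes>\<^bsub>L\<^esub> fraction \<one> s = \<one>\<^bsub>L\<^esub>"
    using assms S_one localization_mult[of s \<one> s \<one> \<one> \<one>] fraction_same by simp
  moreover have "fraction \<one> s \<otimes>\<^bsub>L\<^esub> fraction s \<one> = \<one>\<^bsub>L\<^esub>"
    using assms S_one localization_mult[of \<one> s \<one> s s s] fraction_same by simp
  ultimately show ?thesis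
    using assms S_one by (intro L.inv_unique'[symmetric]) simp_all
qed

lemma localization_left_fraction:
  assumes "a \<in> carrier R" "s \<in> S" "c \<in> carrier R" "a \<otimes> s = s \<otimes> c"
  shows "inv\<^bsub>L\<^esub> (fraction s \<one>) \<otimes>\<^bsub>L\<^esub> fraction a \<one> = fraction c s"
  using assms S_one localization_mult[of \<one> s \<one> a c s] by (simp add: localization_inv)

end

section \<open>The involution on fractions\<close>

locale star_denominators = normal_denominators +
  fixes st :: "'a \<Rightarrow> 'a"
  assumes st_closed [simp]: "a \<in> carrier R \<Longrightarrow> st a \<in> carrier R"
    and st_st [simp]: "a \<in> carrier R \<Longrightarrow> st (st a) = a"
    and st_add: "\<lbrakk>a \<in> carrier R; b \<in> carrier R\<rbrakk> \<Longrightarrow> st (a \<oplus> b) = st a \<oplus> st b"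
    and st_mult: "\<lbrakk>a \<in> carrier R; b \<in> carrier R\<rbrakk> \<Longrightarrow> st (a \<otimes> b) = st b \<otimes> st a"
    and st_S: "s \<in> S \<Longrightarrow> st s = s"
begin

definition fraction_star :: "('a \<times> 'a) set \<Rightarrow> ('a \<times> 'a) set" where
  "fraction_star F = (THE G. \<forall>(a, s)\<in>F. G = inv\<^bsub>L\<^esub> (fraction (st s) \<one>) \<otimes>\<^bsub>L\<^esub> fraction (st a) \<one>)"

text \<open>As denominators are self-adjoint, the star of a s^{-1} is the left fraction s^{-1} a^*,
  and \<open>normal\<close> rewrites it over the same \<open>s\<close>. For independence of the
  representative, the relation a s' w = a' s w is starred, which puts the denominators on the left;
  \<open>left_cancel_imp_right\<close> brings them back.\<close>

lemma fraction_star_eq: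
  assumes "a \<in> carrier R" "s \<in> S" "c \<in> carrier R" "st a \<otimes> s = s \<otimes> c"
  shows "fraction_star (fraction a s) = fraction c s"
proof -
  have 1: "inv\<^bsub>L\<^esub> (fraction (st s') \<one>) \<otimes>\<^bsub>L\<^esub> fraction (st a') \<one> = fraction c s" if "(a', s') \<in> fraction a s" for a' s'
  proof -
    have *: "a' \<in> carrier R" "s' \<in> S" "fraction a' s' = fraction a s"
      using that assms by (simp_all add: mem_fraction_iff)
    obtain c' where c': "c' \<in> carrier R" "st a' \<otimes> s' = s' \<otimes> c'"
      using normal[of s' "st a'"] * by auto
    obtain w where w: "w \<in> S" "a \<otimes> (s' \<otimes> w) = a' \<otimes> (s \<otimes> w)"
      using * assms fraction_eq_iff by metis
    have "st (a \<otimes> (s' \<otimes> w)) = w \<otimes> s' \<otimes> st a"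
      using * assms w(1) by (simp add: st_mult st_S)
    moreover have "st (a' \<otimes> (s \<otimes> w)) = w \<otimes> s \<otimes> st a'"
      using * assms w(1) by (simp add: st_mult st_S)
    ultimately have eq: "w \<otimes> s' \<otimes> st a = w \<otimes> s \<otimes> st a'" using w by simp
    \<comment> \<open>The aim is a common left factor w s s' in front of c s' and c' s, the two
      numerators over a common denominator.\<close>
    have "(w \<otimes> s \<otimes> s') \<otimes> (c \<otimes> s') = w \<otimes> s' \<otimes> (s \<otimes> c) \<otimes> s'"
      using assms(1-3) * w(1) by (simp add: S_ac)
    also have "\<dots> = (w \<otimes> s' \<otimes> st a) \<otimes> (s \<otimes> s')"
      unfolding assms(4)[symmetric] using assms(1-3) * w(1) by (simp add: m_assoc)
    also have "\<dots> = (w \<otimes> s) \<otimes> (st a' \<otimes> s') \<otimes> s"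
      unfolding eq using assms(1-3) * w(1) by (simp add: S_ac)
    also have "\<dots> = (w \<otimes> s \<otimes> s') \<otimes> (c' \<otimes> s)"
      unfolding c'(2) using assms(1-3) * w(1) c'(1) by (simp add: m_assoc)
    finally have eq': "(w \<otimes> s \<otimes> s') \<otimes> (c \<otimes> s') = (w \<otimes> s \<otimes> s') \<otimes> (c' \<otimes> s)" .
    have "(c \<otimes> s') \<otimes> (w \<otimes> s \<otimes> s') = (c' \<otimes> s) \<otimes> (w \<otimes> s \<otimes> s')"
      by (rule left_cancel_imp_right[OF _ _ _ eq']) (use assms(1-3) * w(1) c'(1) in \<open>simp_all add: S_mult\<close>)
    then have "fraction c s = fraction c' s'"
      using assms * w c' by (subst fraction_eq_iff) (auto simp: m_assoc S_mult intro!: bexI[of _ "w \<otimes> s \<otimes> s'"])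
    then show ?thesis
      using localization_left_fraction[of "st a'" s' c'] * c' by (simp add: st_S)
  qed
  have "(a, s) \<in> fraction a s" using assms mem_fraction_iff by blast
  then show ?thesis
    unfolding fraction_star_def using 1 by (intro the_equality) fastforce+
qed

lemma fraction_starE:
  assumes "a \<in> carrier R" "s \<in> S"
  obtains c where "c \<in> carrier R" "st a \<otimes> s = s \<otimes> c" "fraction_star (fraction a s) = fraction c s"
  using normal[of s "st a"] assms fraction_star_eq by auto

lemma fraction_star_involution:
  assumes "x \<in> carrier L"
  shows "fraction_star (fraction_star x) = x"
proof -
  obtain a s where a: "a \<in> carrier R" "s \<in> S" "x = fraction a s" using assms localizationE by metis
  obtain c where c: "c \<in> carrier R" "st a \<otimes> s = s \<otimes> c" "fraction_star (fraction a s) = fraction c s"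
    using fraction_starE a by metis
  \<comment> \<open>Starring the equation that defines \<open>c\<close> gives the equation saying
    that \<open>a\<close> is the twist of \<open>st c\<close>, that is, the star taken a second
    time.\<close>
  have "st (s \<otimes> c) = s \<otimes> a"
    unfolding c(2)[symmetric] using a by (simp add: st_mult st_S)
  then have "st c \<otimes> s = s \<otimes> a" using a c(1) by (simp add: st_mult st_S)
  then show ?thesis using a c by (simp add: fraction_star_eq)
qed

lemma fraction_star_add:
  assumes "x \<in> carrier L" "y \<in> carrier L"
  shows "fraction_star (x \<oplus>\<^bsub>L\<^esub> y) = fraction_star x \<oplus>\<^bsub>L\<^esub> fraction_star y"
proof -
  obtain a b s where a: "a \<in> carrier R" "b \<in> carrier R" "s \<in> S" "x = fraction a s" "y = fraction b s"
    using assms common_denominator2 by metis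
  obtain c where c: "c \<in> carrier R" "st a \<otimes> s = s \<otimes> c" "fraction_star (fraction a s) = fraction c s"
    using fraction_starE a by metis
  obtain d where d: "d \<in> carrier R" "st b \<otimes> s = s \<otimes> d" "fraction_star (fraction b s) = fraction d s"
    using fraction_starE a by metis
  have "st (a \<oplus> b) \<otimes> s = s \<otimes> (c \<oplus> d)" using a c d by (simp add: st_add l_distr r_distr)
  then show ?thesis using a c d by (simp add: localization_add_same fraction_star_eq)
qed

lemma fraction_star_mult:
  assumes "x \<in> carrier L" "y \<in> carrier L"
  shows "fraction_star (x \<otimes>\<^bsub>L\<^esub> y) = fraction_star y \<otimes>\<^bsub>L\<^esub> fraction_star x"
proof -
  obtain a s where a: "a \<in> carrier R" "s \<in> S" "x = fraction a s" using assms localizationE by metis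
  obtain b t where b: "b \<in> carrier R" "t \<in> S" "y = fraction b t" using assms localizationE by metis
  obtain d where d: "d \<in> carrier R" "b \<otimes> s = s \<otimes> d" using normal a b by blast
  obtain a' where a': "a' \<in> carrier R" "st a \<otimes> s = s \<otimes> a'" "fraction_star x = fraction a' s"
    using fraction_starE a by metis
  obtain b' where b': "b' \<in> carrier R" "st b \<otimes> t = t \<otimes> b'" "fraction_star y = fraction b' t"
    using fraction_starE b by metis
  obtain e where e: "e \<in> carrier R" "a' \<otimes> t = t \<otimes> e" using normal a' b by blast
  \<comment> \<open>Starring b s = s d shows how \<open>st d\<close> passes \<open>s\<close>; this
    links the twist used in the product to the one used in the star.\<close>
  have "st (b \<otimes> s) = s \<otimes> st b" using a b by (simp add: st_mult st_S)
  then have sb: "st d \<otimes> s = s \<otimes> st b" using a d by (simp add: st_mult st_S)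
  have "st (a \<otimes> d) \<otimes> (t \<otimes> s) = st d \<otimes> (st a \<otimes> s) \<otimes> t"
    using a b d(1) by (simp add: S_ac st_mult)
  also have "\<dots> = (st d \<otimes> s) \<otimes> (a' \<otimes> t)"
    unfolding a'(2) using a b d(1) a'(1) by (simp add: m_assoc)
  also have "\<dots> = s \<otimes> (st b \<otimes> t) \<otimes> e"
    unfolding sb e(2) using a b d(1) a'(1) e(1) by (simp add: m_assoc)
  also have "\<dots> = (t \<otimes> s) \<otimes> (b' \<otimes> e)"
    unfolding b'(2) using a b b'(1) e(1) by (simp add: S_ac)
  finally have "fraction_star (x \<otimes>\<^bsub>L\<^esub> y) = fraction (b' \<otimes> e) (t \<otimes> s)"
    using a b d b' e(1) by (simp add: localization_mult[of a s t b d s] fraction_star_eq S_mult)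
  also have "\<dots> = fraction (b' \<otimes> e) (s \<otimes> t)" using a b S_comm by simp
  also have "\<dots> = fraction_star y \<otimes>\<^bsub>L\<^esub> fraction_star x"
    using a b a' b' e by (simp add: localization_mult[of b' t s a' e t])
  finally show ?thesis .
qed

end

subsection \<open>The free algebra\<close>

lemma ring_of_type_algebra_simps [simp]:
  "carrier (ring_of_type_algebra :: 'a::ring_1 ring) = UNIV"
  "x \<otimes>\<^bsub>ring_of_type_algebra\<^esub> y = x * y"
  "x \<oplus>\<^bsub>ring_of_type_algebra\<^esub> y = x + y"
  "\<one>\<^bsub>ring_of_type_algebra\<^esub> = 1"
  "\<zero>\<^bsub>ring_of_type_algebra\<^esub> = 0"
  by (simp_all add: ring_of_type_algebra_def)

lemma ring_free_ring: "ring free_ring"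
proof (rule ringI)
  show "abelian_group free_ring"
    by (rule abelian_groupI) (auto simp: algebra_simps intro: exI[of _ "- x" for x])
qed (auto simp: algebra_simps intro!: monoidI)

interpretation free_ring: ring free_ring
  by (rule ring_free_ring)

lemma free_ring_uminus [simp]: "\<ominus>\<^bsub>free_ring\<^esub> x = - x"
  by (rule free_ring.minus_equality) simp_all

text \<open>For claims additive in \<open>p\<close>, such as the commutation laws below, this leaves
  a single scaled word, on which induction over its letters is possible.\<close>

lemma poly_mapping_single_induct [case_names single add]:
  assumes "\<And>k c. P (Poly_Mapping.single k c)" "\<And>p r. P p \<Longrightarrow> P r \<Longrightarrow> P (p + r)"
  shows "P (p :: 'a \<Rightarrow>\<^sub>0 'b::comm_monoid_add)"
proof (induction p rule: update_induct)
  case const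
  show ?case using assms(1)[of undefined 0] by simp
next
  case (update p a b)
  have "Poly_Mapping.update a b p = p + Poly_Mapping.single a b"
    using update(1)
    by (intro poly_mapping_eqI) (auto simp: lookup_update lookup_add lookup_single in_keys_iff when_def)
  then show ?case using assms update by simp
qed

lemma poly_mapping_sum_single:
  "(\<Sum>k\<in>Poly_Mapping.keys p. Poly_Mapping.single k (Poly_Mapping.lookup p k)) = (p :: 'a \<Rightarrow>\<^sub>0 'b::comm_monoid_add)"
  by (rule poly_mapping_eqI)
    (auto simp: lookup_sum lookup_single when_def in_keys_iff)

lemma const_mult: "const (a * b) = const a * const b"
  by (simp add: const_def mult_single)

lemma const_add: "const (a + b) = const a + const b"
  by (simp add: const_def single_add)

lemma const_0 [simp]: "const 0 = 0" and const_1 [simp]: "const 1 = 1"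
  by (simp_all add: const_def)

lemma const_mult_single: "const c * Poly_Mapping.single w d = Poly_Mapping.single w (c * d)"
  by (simp add: const_def mult_single)

lemma const_comm: "p * const c = const c * p"
  by (induction p rule: poly_mapping_single_induct)
    (simp_all add: const_def mult_single mult.commute distrib_left distrib_right)

lemma const_lcomm: "p * (const c * r) = const c * (p * r)"
  by (metis const_comm mult.assoc)

lemma gen_const: "gen g * const c = const c * gen g" "gen g * (const c * p) = const c * (gen g * p)"
  by (rule const_comm, rule const_lcomm)

lemma const_const: "const a * (const b * p) = const (a * b) * p"
  by (simp add: const_mult mult.assoc)

lemma gen_mult_single:
  "gen g * Poly_Mapping.single (Free_Monoid ws) c = Poly_Mapping.single (Free_Monoid (g # ws)) c"
  by (simp add: gen_def mult_single plus_free_monoid_def)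

lemma free_monoid_cases: obtains ws where "w = Free_Monoid ws"
  by (cases w) auto

section \<open>Homogeneous polynomials and weight components\<close>

definition homogeneous :: "(pluecker free_monoid \<Rightarrow> 'g) \<Rightarrow> 'g \<Rightarrow> free_alg \<Rightarrow> bool" where
  "homogeneous f v p \<longleftrightarrow> (\<forall>w\<in>Poly_Mapping.keys p. f w = v)"

lemma homogeneous_0 [simp]: "homogeneous f v 0"
  by (simp add: homogeneous_def)

text \<open>Twists by denominators never enlarge the support, so this carries word length and weight
  through them at once.\<close>

lemma homogeneous_subset:
  "homogeneous f v p \<Longrightarrow> Poly_Mapping.keys r \<subseteq> Poly_Mapping.keys p \<Longrightarrow> homogeneous f v r"
  by (auto simp: homogeneous_def)

lemma homogeneous_single: "f w = v \<Longrightarrow> homogeneous f v (Poly_Mapping.single w c)"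
  by (simp add: homogeneous_def)

lemma homogeneous_add: "homogeneous f v p \<Longrightarrow> homogeneous f v r \<Longrightarrow> homogeneous f v (p + r)"
  using Poly_Mapping.keys_add[of p r] by (auto simp: homogeneous_def)

lemma homogeneous_uminus: "homogeneous f v p \<Longrightarrow> homogeneous f v (- p)"
  by (simp add: homogeneous_def)

lemma homogeneous_diff: "homogeneous f v p \<Longrightarrow> homogeneous f v r \<Longrightarrow> homogeneous f v (p - r)"
  using homogeneous_add[OF _ homogeneous_uminus, of f v p r] by simp

lemma homogeneous_sum: "(\<And>x. x \<in> A \<Longrightarrow> homogeneous f v (p x)) \<Longrightarrow> homogeneous f v (\<Sum>x\<in>A. p x)"
  by (induction A rule: infinite_finite_induct) (auto intro: homogeneous_add)

lemma homogeneous_mult: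
  assumes "\<And>v w. f (v + w) = f v + f w" "homogeneous f u p" "homogeneous f v r"
  shows "homogeneous f (u + v) (p * r)"
  using assms keys_mult[of p r] by (fastforce simp: homogeneous_def)

definition word_length :: "'a free_monoid \<Rightarrow> nat" where
  "word_length w = length (letters w)"

lemma word_length_add [simp]: "word_length (v + w) = word_length v + word_length w"
  and word_length_0 [simp]: "word_length 0 = 0"
  by (simp_all add: word_length_def plus_free_monoid_def zero_free_monoid_def)

lemma word_weight_add [simp]: "word_weight (v + w) = word_weight v + word_weight w"
  and word_weight_0 [simp]: "word_weight 0 = 0"
  by (simp_all add: word_weight_def plus_free_monoid_def zero_free_monoid_def)

abbreviation "hdegree \<equiv> homogeneous word_length"
abbreviation "hweight \<equiv> homogeneous word_weight"

lemma hdegree_mult: "hdegree m p \<Longrightarrow> hdegree n r \<Longrightarrow> hdegree (m + n) (p * r)"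
  and hweight_mult: "hweight u p \<Longrightarrow> hweight v r \<Longrightarrow> hweight (u + v) (p * r)"
  by (simp_all add: homogeneous_mult)

lemma hdegree_gen: "hdegree 1 (gen g)"
  and hweight_gen: "hweight (gen_weight g) (gen g)"
  by (simp_all add: gen_def homogeneous_single word_length_def word_weight_def)

lemma hdegree_const: "hdegree 0 (const c)"
  and hweight_const: "hweight 0 (const c)"
  by (simp_all add: const_def homogeneous_single)

lemma hdegree_one: "hdegree 0 1"
  and hweight_one: "hweight 0 1"
  using hdegree_const[of 1] hweight_const[of 1] by simp_all

lemma hdegree_const_mult: "hdegree n p \<Longrightarrow> hdegree n (const c * p)"
  and hweight_const_mult: "hweight v p \<Longrightarrow> hweight v (const c * p)"
  using hdegree_mult[OF hdegree_const, of n p c] hweight_mult[OF hweight_const, of v p c] by simp_all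

text \<open>Operators diagonal in the basis of words. Both the projection to a weight and the twist
  by \<open>gen P12\<close> have this shape.\<close>

definition scale :: "(pluecker free_monoid \<Rightarrow> complex) \<Rightarrow> free_alg \<Rightarrow> free_alg" where
  "scale f p = Poly_Mapping.mapp (\<lambda>w c. f w * c) p"

lemma lookup_scale: "Poly_Mapping.lookup (scale f p) w = f w * Poly_Mapping.lookup p w"
  by (simp add: scale_def lookup_mapp when_def in_keys_iff)

lemma keys_scale: "Poly_Mapping.keys (scale f p) \<subseteq> Poly_Mapping.keys p"
  unfolding scale_def by (rule keys_mapp_subset)

lemma scale_add: "scale f (p + r) = scale f p + scale f r"
  by (rule poly_mapping_eqI) (simp add: lookup_scale lookup_add distrib_left)

lemma scale_0 [simp]: "scale f 0 = 0"
  by (rule poly_mapping_eqI) (simp add: lookup_scale)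

lemma scale_sum: "scale f (\<Sum>x\<in>A. p x) = (\<Sum>x\<in>A. scale f (p x))"
  by (induction A rule: infinite_finite_induct) (auto simp: scale_add)

lemma scale_single: "scale f (Poly_Mapping.single w c) = Poly_Mapping.single w (f w * c)"
  by (rule poly_mapping_eqI) (simp add: lookup_scale lookup_single when_def)

lemma scale_scale: "scale f (scale g p) = scale (\<lambda>w. f w * g w) p"
  by (rule poly_mapping_eqI) (simp add: lookup_scale mult.assoc)

lemma scale_one [simp]: "scale (\<lambda>w. 1) p = p"
  by (rule poly_mapping_eqI) (simp add: lookup_scale)

definition component :: "int \<times> int \<Rightarrow> free_alg \<Rightarrow> free_alg" where
  "component v = scale (\<lambda>w. if word_weight w = v then 1 else 0)"

lemma keys_component:
  "Poly_Mapping.keys (component v p) = {w \<in> Poly_Mapping.keys p. word_weight w = v}"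
  by (auto simp: component_def in_keys_iff lookup_scale split: if_splits)

lemma hweight_component: "hweight v (component v p)"
  by (simp add: homogeneous_def keys_component)

lemma component_hweight:
  assumes "hweight u p"
  shows "component v p = (if v = u then p else 0)"
  by (rule poly_mapping_eqI)
    (use assms in \<open>auto simp: component_def lookup_scale homogeneous_def in_keys_iff\<close>)

lemma component_add: "component v (p + r) = component v p + component v r"
  by (simp add: component_def scale_add)

lemma component_0 [simp]: "component v 0 = 0"
  by (simp add: component_def)

lemma component_sum: "component v (\<Sum>x\<in>A. p x) = (\<Sum>x\<in>A. component v (p x))"
  by (simp add: component_def scale_sum)

lemma sum_components:
  assumes "finite V" "word_weight ` Poly_Mapping.keys p \<subseteq> V"
  shows "(\<Sum>v\<in>V. component v p) = p"
proof (rule poly_mapping_eqI)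
  fix w
  have "Poly_Mapping.lookup (\<Sum>v\<in>V. component v p) w
      = (\<Sum>v\<in>V. if word_weight w = v then Poly_Mapping.lookup p w else 0)"
    by (auto simp: lookup_sum component_def lookup_scale intro!: sum.cong)
  also have "\<dots> = Poly_Mapping.lookup p w"
    using assms by (cases "w \<in> Poly_Mapping.keys p") (auto simp: in_keys_iff)
  finally show "Poly_Mapping.lookup (\<Sum>v\<in>V. component v p) w = Poly_Mapping.lookup p w" .
qed

lemma component_mult_single:
  "component v (p * Poly_Mapping.single w c) = component (v - word_weight w) p * Poly_Mapping.single w c"
proof (induction p rule: poly_mapping_single_induct)
  case (single k d)
  then show ?case by (auto simp: mult_single component_def scale_single algebra_simps)
qed (simp_all add: component_add distrib_right)

lemma component_single_mult:
  "component v (Poly_Mapping.single w c * p) = Poly_Mapping.single w c * component (v - word_weight w) p"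
proof (induction p rule: poly_mapping_single_induct)
  case (single k d)
  then show ?case by (auto simp: mult_single component_def scale_single algebra_simps)
qed (simp_all add: component_add distrib_left)

lemma component_mult_hweight:
  assumes "hweight u h"
  shows "component v (p * h) = component (v - u) p * h"
proof -
  have "component v (p * h) = component v (\<Sum>k\<in>Poly_Mapping.keys h. p * Poly_Mapping.single k (Poly_Mapping.lookup h k))"
    by (subst poly_mapping_sum_single[of h, symmetric]) (simp add: sum_distrib_left)
  also have "\<dots> = (\<Sum>k\<in>Poly_Mapping.keys h. component (v - u) p * Poly_Mapping.single k (Poly_Mapping.lookup h k))"
    unfolding component_sum using assms
    by (intro sum.cong refl) (simp add: component_mult_single homogeneous_def)
  also have "\<dots> = component (v - u) p * h"
    by (subst (3) poly_mapping_sum_single[of h, symmetric]) (simp add: sum_distrib_left)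
  finally show ?thesis .
qed

lemma component_hweight_mult:
  assumes "hweight u h"
  shows "component v (h * p) = h * component (v - u) p"
proof -
  have "component v (h * p) = component v (\<Sum>k\<in>Poly_Mapping.keys h. Poly_Mapping.single k (Poly_Mapping.lookup h k) * p)"
    by (subst poly_mapping_sum_single[of h, symmetric]) (simp add: sum_distrib_right)
  also have "\<dots> = (\<Sum>k\<in>Poly_Mapping.keys h. Poly_Mapping.single k (Poly_Mapping.lookup h k) * component (v - u) p)"
    unfolding component_sum using assms
    by (intro sum.cong refl) (simp add: component_single_mult homogeneous_def)
  also have "\<dots> = h * component (v - u) p"
    by (subst (3) poly_mapping_sum_single[of h, symmetric]) (simp add: sum_distrib_right)
  finally show ?thesis .
qed

section \<open>Commutation exponents and the involution on the free algebra\<close>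

definition pairing :: "int \<times> int \<Rightarrow> int \<times> int \<Rightarrow> int" where
  "pairing u v = fst u * snd v - snd u * fst v"

text \<open>Only the index pairs (1,2) and (2,1) contribute, with factors q^2 and q^{-2}. Counting
  them gives twice the determinant of the two weights, so the commutation factor depends on weights
  alone and is bimultiplicative.\<close>

lemma q_coeff_prod:
  assumes "0 < q"
  shows "(\<Prod>j\<leftarrow>indices g. \<Prod>k\<leftarrow>indices h. (q_coeff q j k)\<^sup>2) = q powi (2 * pairing (gen_weight g) (gen_weight h))"
  using assms
  by (cases g; cases h; simp add: q_coeff_def pairing_def gen_weight_def power_int_minus power_inverse
      power_int_numeral field_simps)

text \<open>The involution sends a generator to a multiple of a generator; on index sets it is the
  permutation exchanging 1 with 2 and 3 with 4.\<close>

primrec conj_gen :: "pluecker \<Rightarrow> pluecker" where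
  "conj_gen P12 = P12" | "conj_gen P13 = P24" | "conj_gen P14 = P23"
| "conj_gen P23 = P14" | "conj_gen P24 = P13" | "conj_gen P34 = P34"

primrec conj_coeff :: "real \<Rightarrow> pluecker \<Rightarrow> real" where
  "conj_coeff q P12 = 1" | "conj_coeff q P13 = q" | "conj_coeff q P14 = - inverse q"
| "conj_coeff q P23 = - q" | "conj_coeff q P24 = inverse q" | "conj_coeff q P34 = 1"

lemma const_uminus: "const (- c) = - const c"
  by (simp add: const_def single_uminus)

lemma gen_star_eq: "gen_star q g = const (of_real (conj_coeff q g)) * gen (conj_gen g)"
  by (cases g) (simp_all add: gen_star_def const_uminus)

text \<open>Exchanging the indices 1 and 2 swaps the coordinates of both weights and negates the
  determinant; exchanging the arguments negates it again. Hence reversing the order of products is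
  compatible with the commutation factors.\<close>

lemma pairing_conj_gen:
  "pairing (gen_weight (conj_gen h)) (gen_weight (conj_gen g)) = pairing (gen_weight g) (gen_weight h)"
  by (cases g; cases h; simp add: pairing_def gen_weight_def)

definition word_star :: "real \<Rightarrow> pluecker free_monoid \<Rightarrow> free_alg" where
  "word_star q w = prod_list (map (gen_star q) (rev (letters w)))"

lemma word_star_add: "word_star q (v + w) = word_star q w * word_star q v"
  and word_star_0 [simp]: "word_star q 0 = 1"
  by (simp_all add: word_star_def plus_free_monoid_def zero_free_monoid_def)

lemma free_star_superset:
  assumes "finite A" "Poly_Mapping.keys p \<subseteq> A"
  shows "free_star q p = (\<Sum>w\<in>A. const (cnj (Poly_Mapping.lookup p w)) * word_star q w)"
  unfolding free_star_def word_star_def[symmetric]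
  using assms by (intro sum.mono_neutral_left) (auto simp: in_keys_iff)

lemma free_star_add: "free_star q (p + r) = free_star q p + free_star q r"
proof -
  let ?A = "Poly_Mapping.keys p \<union> Poly_Mapping.keys r"
  have "Poly_Mapping.keys (p + r) \<subseteq> ?A" by (rule Poly_Mapping.keys_add)
  then show ?thesis
    by (subst (1 2 3) free_star_superset[of ?A]) (simp_all add: lookup_add const_add distrib_right sum.distrib)
qed

lemma free_star_single: "free_star q (Poly_Mapping.single w c) = const (cnj c) * word_star q w"
  by (subst free_star_superset[of "{w}"]) auto

lemma free_star_0 [simp]: "free_star q 0 = 0"
  by (simp add: free_star_def)

lemma free_star_const: "free_star q (const c) = const (cnj c)"
  using free_star_single[of q 0 c] by (simp add: const_def[of c])

lemma free_star_gen: "free_star q (gen g) = gen_star q g"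
  by (simp add: gen_def free_star_single word_star_def)

lemma free_star_mult: "free_star q (p * r) = free_star q r * free_star q p"
proof (induction p rule: poly_mapping_single_induct)
  case (single v c)
  show ?case
  proof (induction r rule: poly_mapping_single_induct)
    case (single w d)
    have "free_star q (Poly_Mapping.single w d) * free_star q (Poly_Mapping.single v c)
        = const (cnj d) * (const (cnj c) * (word_star q w * word_star q v))"
      by (simp add: free_star_single mult.assoc const_lcomm[of "word_star q w"])
    then show ?case
      by (simp add: mult_single free_star_single word_star_add const_const mult.commute[of c])
  qed (simp_all add: distrib_left distrib_right free_star_add)
qed (simp_all add: distrib_left distrib_right free_star_add)

lemma free_star_uminus: "free_star q (- p) = - free_star q p"
  using free_star_add[of q p "- p"] by (simp add: eq_neg_iff_add_eq_0 add.commute)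

lemma free_star_diff: "free_star q (p - r) = free_star q p - free_star q r"
  using free_star_add[of q p "- r"] by (simp add: free_star_uminus)

text \<open>The coefficients at \<open>g\<close> and at \<open>conj_gen g\<close> are real and
  mutually inverse.\<close>

lemma free_star_gen_star: "q \<noteq> 0 \<Longrightarrow> free_star q (gen_star q g) = gen g"
  by (cases g)
    (simp_all add: gen_star_eq free_star_mult free_star_const free_star_gen gen_const
      mult.assoc const_const)

lemma free_star_word_star:
  assumes "q \<noteq> 0"
  shows "free_star q (word_star q (Free_Monoid ws)) = Poly_Mapping.single (Free_Monoid ws) 1"
proof (induction ws)
  case Nil
  then show ?case
    using free_star_const[of q 1] by (simp add: zero_free_monoid_def[symmetric])
next
  case (Cons g ws)
  have "word_star q (Free_Monoid (g # ws)) = word_star q (Free_Monoid ws) * gen_star q g"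
    by (simp add: word_star_def)
  then show ?case
    using Cons assms by (simp add: free_star_mult free_star_gen_star gen_mult_single)
qed

lemma free_star_free_star:
  assumes "q \<noteq> 0"
  shows "free_star q (free_star q p) = p"
proof (induction p rule: poly_mapping_single_induct)
  case (single w c)
  obtain ws where "w = Free_Monoid ws" by (rule free_monoid_cases)
  then show ?case
    using assms by (simp add: free_star_single free_star_mult free_star_word_star free_star_const const_comm[of "Poly_Mapping.single _ _"] const_mult_single)
qed (simp add: free_star_add)

lemma hdegree_word_star: "hdegree (word_length w) (word_star q w)"
proof -
  have "hdegree (length gs) (prod_list (map (gen_star q) gs))" for gs
  proof (induction gs)
    case Nil
    then show ?case by (simp add: hdegree_one)
  next
    case (Cons g gs)
    then show ?case
      using hdegree_mult[OF hdegree_const_mult[OF hdegree_gen]] by (simp add: gen_star_eq)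
  qed
  from this[of "rev (letters w)"] show ?thesis
    by (simp add: word_star_def word_length_def)
qed

lemma hdegree_free_star:
  assumes "hdegree n p"
  shows "hdegree n (free_star q p)"
  unfolding free_star_def word_star_def[symmetric]
proof (rule homogeneous_sum)
  fix w assume "w \<in> Poly_Mapping.keys p"
  with assms have "word_length w = n" by (simp add: homogeneous_def)
  then show "hdegree n (const (cnj (Poly_Mapping.lookup p w)) * word_star q w)"
    using hdegree_word_star[of w q] by (intro hdegree_const_mult) simp
qed

subsection \<open>The ideal of relations\<close>

lemma ideal_rel_ideal: "ideal (rel_ideal q) free_ring"
  unfolding rel_ideal_def by (rule free_ring.genideal_ideal) simp

lemma relations_subset_rel_ideal: "relations q \<subseteq> rel_ideal q"
  unfolding rel_ideal_def by (rule free_ring.genideal_self) simp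

text \<open>The elements satisfying \<open>P\<close> form an ideal: zero and negatives arise from
  \<open>left\<close> with the factors 0 and -1.\<close>

lemma rel_ideal_induct [consumes 1, case_names relation add left right]:
  assumes "x \<in> rel_ideal q"
    and rel: "\<And>r. r \<in> relations q \<Longrightarrow> P r"
    and add: "\<And>a b. P a \<Longrightarrow> P b \<Longrightarrow> P (a + b)"
    and left: "\<And>a b. P b \<Longrightarrow> P (a * b)"
    and right: "\<And>a b. P a \<Longrightarrow> P (a * b)"
  shows "P x"
proof -
  have "ideal {x. P x} free_ring"
  proof (rule idealI[OF ring_free_ring])
    have "\<exists>r. r \<in> relations q" unfolding relations_def by blast
    then have "P 0" using rel left[of _ 0] by auto
    moreover have "P (inv\<^bsub>add_monoid free_ring\<^esub> a)" if "P a" for a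
      unfolding a_inv_def[symmetric] using left[OF that, of "- 1"] by simp
    ultimately show "subgroup {x. P x} (add_monoid free_ring)"
      using add by (intro group.subgroupI[OF free_ring.add.is_group]) (auto simp del: ring_of_type_algebra_simps(5))
  qed (use left right in auto)
  then have "rel_ideal q \<subseteq> {x. P x}"
    unfolding rel_ideal_def using rel by (intro free_ring.genideal_minimal) auto
  with assms(1) show ?thesis by blast
qed

section \<open>Congruence modulo the relations and the quotient ring\<close>

context
  fixes q :: real
begin

interpretation I: ideal "rel_ideal q" free_ring
  by (rule ideal_rel_ideal)

lemma rel_ideal_0 [simp]: "0 \<in> rel_ideal q"
  using I.zero_closed by simp

lemma rel_ideal_add: "a \<in> rel_ideal q \<Longrightarrow> b \<in> rel_ideal q \<Longrightarrow> a + b \<in> rel_ideal q"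
  using I.a_closed by simp

lemma rel_ideal_uminus: "a \<in> rel_ideal q \<Longrightarrow> - a \<in> rel_ideal q"
  using I.a_inv_closed by simp

lemma rel_ideal_diff: "a \<in> rel_ideal q \<Longrightarrow> b \<in> rel_ideal q \<Longrightarrow> a - b \<in> rel_ideal q"
  using rel_ideal_add[OF _ rel_ideal_uminus, of a b] by simp

lemma rel_ideal_left: "a \<in> rel_ideal q \<Longrightarrow> b * a \<in> rel_ideal q"
  using I.I_l_closed[of a b] by simp

lemma rel_ideal_right: "a \<in> rel_ideal q \<Longrightarrow> a * b \<in> rel_ideal q"
  using I.I_r_closed[of a b] by simp

lemma rel_ideal_sum: "(\<And>x. x \<in> A \<Longrightarrow> f x \<in> rel_ideal q) \<Longrightarrow> (\<Sum>x\<in>A. f x) \<in> rel_ideal q"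
  by (induction A rule: infinite_finite_induct) (auto intro: rel_ideal_add)

text \<open>Congruence of polynomials is used in place of equality of cosets because support, degree
  and weight can be read off from a polynomial but not from its coset.\<close>

definition eqv :: "free_alg \<Rightarrow> free_alg \<Rightarrow> bool" where
  "eqv p r \<longleftrightarrow> p - r \<in> rel_ideal q"

lemma mem_cls_iff: "x \<in> cls q p \<longleftrightarrow> x - p \<in> rel_ideal q"
  by (auto simp: cls_def a_r_coset_def' intro!: bexI[of _ "x - p"])

lemma cls_eq_iff: "cls q p = cls q r \<longleftrightarrow> eqv p r"
proof
  assume "cls q p = cls q r"
  then have "p \<in> cls q r" using mem_cls_iff[of p p] by simp
  then show "eqv p r" by (simp add: mem_cls_iff eqv_def)
next
  assume "eqv p r"
  then have "x - p \<in> rel_ideal q \<longleftrightarrow> x - r \<in> rel_ideal q" for x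
    using rel_ideal_add[of "x - p" "p - r"] rel_ideal_diff[of "x - r" "p - r"] by (auto simp: eqv_def)
  then show "cls q p = cls q r" by (auto simp: mem_cls_iff)
qed

lemma Gr_simps:
  "carrier (Gr q) = range (cls q)"
  "cls q p \<otimes>\<^bsub>Gr q\<^esub> cls q r = cls q (p * r)"
  "cls q p \<oplus>\<^bsub>Gr q\<^esub> cls q r = cls q (p + r)"
  "\<one>\<^bsub>Gr q\<^esub> = cls q 1"
  "\<zero>\<^bsub>Gr q\<^esub> = cls q 0"
proof -
  show "carrier (Gr q) = range (cls q)"
    by (auto simp: Gr_def FactRing_def A_RCOSETS_def' cls_def)
  show "cls q p \<otimes>\<^bsub>Gr q\<^esub> cls q r = cls q (p * r)"
    using I.rcoset_mult_add[of p r] by (simp add: Gr_def FactRing_def cls_def)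
  show "cls q p \<oplus>\<^bsub>Gr q\<^esub> cls q r = cls q (p + r)"
    using I.a_rcos_sum[of p r] by (simp add: Gr_def FactRing_def cls_def)
  show "\<one>\<^bsub>Gr q\<^esub> = cls q 1"
    by (simp add: Gr_def FactRing_def cls_def)
  show "\<zero>\<^bsub>Gr q\<^esub> = cls q 0"
    using I.a_rcos_const[of 0] by (simp add: Gr_def FactRing_def cls_def)
qed

lemma ring_Gr: "ring (Gr q)"
  unfolding Gr_def by (rule I.quotient_is_ring)

lemma cls_pow: "cls q p [^]\<^bsub>Gr q\<^esub> (n :: nat) = cls q (p ^ n)"
  by (induction n) (simp_all add: Gr_simps power_commutes)

end

lemma eqv_refl [simp]: "eqv q p p"
  by (simp add: eqv_def)

lemma eqv_sym: "eqv q p r \<Longrightarrow> eqv q r p"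
  using rel_ideal_uminus[of "p - r" q] by (simp add: eqv_def)

lemma eqv_trans [trans]: "eqv q a b \<Longrightarrow> eqv q b c \<Longrightarrow> eqv q a c"
  using rel_ideal_add[of "a - b" q "b - c"] by (simp add: eqv_def)

lemma eqv_add: "eqv q a b \<Longrightarrow> eqv q c d \<Longrightarrow> eqv q (a + c) (b + d)"
  using rel_ideal_add[of "a - b" q "c - d"] by (simp add: eqv_def algebra_simps)

lemma eqv_left: "eqv q a b \<Longrightarrow> eqv q (c * a) (c * b)"
  using rel_ideal_left[of "a - b" q c] by (simp add: eqv_def right_diff_distrib)

lemma eqv_right: "eqv q a b \<Longrightarrow> eqv q (a * c) (b * c)"
  using rel_ideal_right[of "a - b" q c] by (simp add: eqv_def left_diff_distrib)

lemma eqv_rel_ideal: "eqv q a b \<Longrightarrow> a \<in> rel_ideal q \<longleftrightarrow> b \<in> rel_ideal q"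
  using rel_ideal_diff[of a q "a - b"] rel_ideal_add[of "a - b" q b] by (auto simp: eqv_def)

lemma eqv_0_iff: "eqv q a 0 \<longleftrightarrow> a \<in> rel_ideal q"
  by (simp add: eqv_def)

lemma eqv_gens:
  assumes "0 < q"
  shows "eqv q (gen g * gen h)
    (const (of_real (q powi (2 * pairing (gen_weight g) (gen_weight h)))) * (gen h * gen g))"
proof -
  have "gen g * gen h
       - const (of_real (\<Prod>j\<leftarrow>indices g. \<Prod>k\<leftarrow>indices h. (q_coeff q j k)\<^sup>2)) * (gen h * gen g) \<in> relations q"
    unfolding relations_def by blast
  then show ?thesis
    unfolding eqv_def q_coeff_prod[OF assms] using relations_subset_rel_ideal by blast
qed

text \<open>All terms of a relation use the same indices with the same multiplicities; in the
  Pluecker relation each of 1, 2, 3, 4 occurs once per term, whence the weight (1, 1).\<close>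

lemma relation_hweight:
  assumes "r \<in> relations q"
  shows "\<exists>v. hweight v r"
proof -
  have gens: "hweight (gen_weight g + gen_weight h) (gen g * gen h)" for g h
    by (intro hweight_mult hweight_gen)
  have "hweight (gen_weight g + gen_weight h) (gen g * gen h - const c * (gen h * gen g))" for g h c
    using gens[of g h] gens[of h g] by (auto intro!: homogeneous_diff hweight_const_mult simp: add.commute)
  moreover have "hweight (1, 1) (gen P12 * gen P34 - const a * (gen P13 * gen P24) + const b * (gen P23 * gen P14))" for a b
    using gens[of P12 P34] gens[of P13 P24] gens[of P23 P14]
    by (auto intro!: homogeneous_diff homogeneous_add hweight_const_mult simp: gen_weight_def)
  ultimately show ?thesis
    using assms unfolding relations_def by blast
qed

lemma component_mult_mem:
  assumes "\<And>v. component v b \<in> rel_ideal q"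
  shows "component v (a * b) \<in> rel_ideal q" and "component v (b * a) \<in> rel_ideal q"
  by (induction a rule: poly_mapping_single_induct)
    (auto simp: component_single_mult component_mult_single component_add distrib_left distrib_right
      intro: assms rel_ideal_left rel_ideal_right rel_ideal_add)

text \<open>An ideal with homogeneous generators is graded. The weight \<open>v\<close> is
  generalized in the induction because a factor shifts the component that has to be
  controlled.\<close>

lemma component_rel_ideal: "x \<in> rel_ideal q \<Longrightarrow> component v x \<in> rel_ideal q"
proof (induction x arbitrary: v rule: rel_ideal_induct)
  case (relation r)
  obtain u where "hweight u r" using relation_hweight[OF relation] by blast
  moreover have "r \<in> rel_ideal q" using relation relations_subset_rel_ideal by blast
  ultimately show ?case by (simp add: component_hweight)
qed (auto simp: component_add intro: rel_ideal_add component_mult_mem)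

lemma rel_ideal_components:
  assumes "\<And>v. component v p \<in> rel_ideal q"
  shows "p \<in> rel_ideal q"
  using rel_ideal_sum[of "word_weight ` Poly_Mapping.keys p" "\<lambda>v. component v p" q] assms
    sum_components[of "word_weight ` Poly_Mapping.keys p" p] by simp

section \<open>Normality of the two denominators\<close>

definition P12_character :: "real \<Rightarrow> pluecker free_monoid \<Rightarrow> complex" where
  "P12_character q w = of_real (q powi (2 * pairing (word_weight w) (gen_weight P12)))"

lemma P12_character_nonzero: "0 < q \<Longrightarrow> P12_character q w \<noteq> 0"
  by (simp add: P12_character_def)

lemma P12_character_Cons:
  "0 < q \<Longrightarrow> P12_character q (Free_Monoid (g # ws)) =
    of_real (q powi (2 * pairing (gen_weight g) (gen_weight P12))) * P12_character q (Free_Monoid ws)"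
  by (simp add: P12_character_def word_weight_def pairing_def power_int_add[symmetric] algebra_simps
      flip: of_real_mult)

text \<open>\<open>gen P12\<close> is moved leftwards letter by letter. The factors collected
  multiply up to the character of the word, since \<open>pairing\<close> is additive in its first
  argument.\<close>

lemma eqv_mult_P12:
  assumes "0 < q"
  shows "eqv q (p * gen P12) (gen P12 * scale (P12_character q) p)"
proof (induction p rule: poly_mapping_single_induct)
  case (single w c)
  obtain ws where w: "w = Free_Monoid ws" by (rule free_monoid_cases)
  show ?case unfolding w
  proof (induction ws)
    case Nil
    have "P12_character q 0 = 1" by (simp add: P12_character_def pairing_def)
    then show ?case
      using const_comm[of "gen P12" c]
      by (simp add: const_def scale_single zero_free_monoid_def[symmetric])
  next
    case (Cons g ws)
    let ?s = "\<lambda>ws. Poly_Mapping.single (Free_Monoid ws) c"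
    let ?c = "const (of_real (q powi (2 * pairing (gen_weight g) (gen_weight P12))))"
    have "eqv q (gen g * (?s ws * gen P12)) (gen g * (gen P12 * scale (P12_character q) (?s ws)))"
      by (rule eqv_left[OF Cons])
    also have "\<dots> = (gen g * gen P12) * scale (P12_character q) (?s ws)"
      by (simp add: mult.assoc)
    also have "eqv q \<dots> (?c * (gen P12 * gen g) * scale (P12_character q) (?s ws))"
      by (rule eqv_right[OF eqv_gens[OF assms]])
    also have "\<dots> = gen P12 * (gen g * (?c * scale (P12_character q) (?s ws)))"
      by (simp add: mult.assoc gen_const)
    also have "\<dots> = gen P12 * scale (P12_character q) (?s (g # ws))"
      using assms by (simp add: scale_single const_mult_single gen_mult_single P12_character_Cons mult.assoc)
    finally show ?case by (simp add: gen_mult_single[symmetric] mult.assoc)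
  qed
qed (simp add: distrib_left distrib_right scale_add eqv_add)

lemma eqv_central_gen:
  assumes "\<And>h. eqv q (gen h * gen g) (gen g * gen h)"
  shows "eqv q (p * gen g) (gen g * p)"
proof (induction p rule: poly_mapping_single_induct)
  case (single w c)
  obtain ws where w: "w = Free_Monoid ws" by (rule free_monoid_cases)
  show ?case unfolding w
  proof (induction ws)
    case Nil
    then show ?case
      using const_comm[of "gen g" c] by (simp add: const_def zero_free_monoid_def[symmetric])
  next
    case (Cons h ws)
    let ?s = "\<lambda>ws. Poly_Mapping.single (Free_Monoid ws) c"
    have "eqv q (gen h * (?s ws * gen g)) (gen h * (gen g * ?s ws))"
      by (rule eqv_left[OF Cons])
    also have "\<dots> = (gen h * gen g) * ?s ws" by (simp add: mult.assoc)
    also have "eqv q \<dots> ((gen g * gen h) * ?s ws)" by (rule eqv_right[OF assms])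
    finally show ?case by (simp add: gen_mult_single[symmetric] mult.assoc)
  qed
qed (simp add: distrib_left distrib_right eqv_add)

lemma eqv_mult_P34:
  assumes "0 < q"
  shows "eqv q (p * gen P34) (gen P34 * p)"
proof (rule eqv_central_gen)
  show "eqv q (gen h * gen P34) (gen P34 * gen h)" for h
    \<comment> \<open>\<open>gen P34\<close> has weight zero, so the exponent of \<open>q\<close>
      vanishes.\<close>
    using eqv_gens[OF assms, of h P34] by (simp add: pairing_def gen_weight_def)
qed

text \<open>The three clauses are bundled because together they pass to products, hence to all
  monomials in the two denominators. The conditions on supports make the twist respect both
  gradings; the second clause serves to turn right fractions into left ones, and the third becomes
  \<open>reversible\<close>.\<close>

definition normal_element :: "real \<Rightarrow> free_alg \<Rightarrow> bool" where
  "normal_element q x \<longleftrightarrow>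
    (\<forall>p. \<exists>r. Poly_Mapping.keys r \<subseteq> Poly_Mapping.keys p \<and> eqv q (p * x) (x * r)) \<and>
    (\<forall>p. \<exists>r. Poly_Mapping.keys r \<subseteq> Poly_Mapping.keys p \<and> eqv q (x * p) (r * x)) \<and>
    (\<forall>p. x * p \<in> rel_ideal q \<longrightarrow> p * x \<in> rel_ideal q)"

lemma normal_element_1: "normal_element q 1"
  by (auto simp: normal_element_def intro: exI[of _ p for p])

lemma normal_element_mult:
  assumes x: "normal_element q x" and y: "normal_element q y"
  shows "normal_element q (x * y)"
  unfolding normal_element_def
proof (intro conjI allI impI)
  fix p
  obtain r where r: "Poly_Mapping.keys r \<subseteq> Poly_Mapping.keys p" "eqv q (p * x) (x * r)"
    using x unfolding normal_element_def by blast
  obtain s where s: "Poly_Mapping.keys s \<subseteq> Poly_Mapping.keys r" "eqv q (r * y) (y * s)"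
    using y unfolding normal_element_def by blast
  have "eqv q (p * (x * y)) (x * y * s)"
    using eqv_trans[OF eqv_right[OF r(2), of y], unfolded mult.assoc, OF eqv_left[OF s(2), of x]]
    by (simp add: mult.assoc)
  then show "\<exists>r. Poly_Mapping.keys r \<subseteq> Poly_Mapping.keys p \<and> eqv q (p * (x * y)) (x * y * r)"
    using r s by blast
next
  fix p
  obtain r where r: "Poly_Mapping.keys r \<subseteq> Poly_Mapping.keys p" "eqv q (y * p) (r * y)"
    using y unfolding normal_element_def by blast
  obtain s where s: "Poly_Mapping.keys s \<subseteq> Poly_Mapping.keys r" "eqv q (x * r) (s * x)"
    using x unfolding normal_element_def by blast
  have "eqv q (x * y * p) (x * (r * y))"
    using eqv_left[OF r(2), of x] by (simp add: mult.assoc)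
  also have "eqv q \<dots> (s * (x * y))"
    using eqv_right[OF s(2), of y] by (simp add: mult.assoc)
  finally show "\<exists>r. Poly_Mapping.keys r \<subseteq> Poly_Mapping.keys p \<and> eqv q (x * y * p) (r * (x * y))"
    using r s by blast
next
  \<comment> \<open>Two cyclic rotations: from x y p to y p x by the property of \<open>x\<close>,
    then to p x y by that of \<open>y\<close>.\<close>
  fix p assume "x * y * p \<in> rel_ideal q"
  then have "y * p * x \<in> rel_ideal q"
    using x unfolding normal_element_def by (metis mult.assoc)
  then have "p * x * y \<in> rel_ideal q"
    using y unfolding normal_element_def by (metis mult.assoc)
  then show "p * (x * y) \<in> rel_ideal q" by (simp add: mult.assoc)
qed

lemma normal_element_power: "normal_element q x \<Longrightarrow> normal_element q (x ^ n)"
  by (induction n) (simp_all add: normal_element_1 normal_element_mult)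

lemma normal_element_P34:
  assumes "0 < q"
  shows "normal_element q (gen P34)"
  unfolding normal_element_def
  using eqv_mult_P34[OF assms] eqv_sym eqv_rel_ideal by blast

lemma normal_element_P12:
  assumes "0 < q"
  shows "normal_element q (gen P12)"
  unfolding normal_element_def
proof (intro conjI allI impI)
  fix p
  show "\<exists>r. Poly_Mapping.keys r \<subseteq> Poly_Mapping.keys p \<and> eqv q (p * gen P12) (gen P12 * r)"
    using eqv_mult_P12[OF assms] keys_scale by blast
  \<comment> \<open>The inverse twist is scaling by the inverse character, which exists since no
    value of the character is zero.\<close>
  have "eqv q (scale (\<lambda>w. inverse (P12_character q w)) p * gen P12) (gen P12 * p)"
    using eqv_mult_P12[OF assms, of "scale (\<lambda>w. inverse (P12_character q w)) p"] assms
    by (simp add: scale_scale P12_character_nonzero)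
  then show "\<exists>r. Poly_Mapping.keys r \<subseteq> Poly_Mapping.keys p \<and> eqv q (gen P12 * p) (r * gen P12)"
    using eqv_sym keys_scale by blast
next
  fix p assume p: "gen P12 * p \<in> rel_ideal q"
  \<comment> \<open>Because the ideal is graded, each weight component \<open>c\<close> of
    \<open>p\<close> also satisfies \<open>gen P12 * c \<in> rel_ideal q\<close>. On
    \<open>c\<close> the twist is multiplication by a constant, so \<open>gen P12\<close> can change
    sides. The shift by \<open>?u\<close> accounts for the weight of \<open>gen P12\<close>.\<close>
  show "p * gen P12 \<in> rel_ideal q"
  proof (rule rel_ideal_components)
    fix v
    let ?u = "gen_weight P12"
    define c where "c = component (v - ?u) p"
    have c: "gen P12 * c \<in> rel_ideal q"
      using component_rel_ideal[OF p, of v] by (simp add: component_hweight_mult[OF hweight_gen] c_def)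
    have "scale (P12_character q) c = const (of_real (q powi (2 * pairing (v - ?u) ?u))) * c"
    proof (rule poly_mapping_eqI)
      fix w
      have "hweight (v - ?u) c" by (simp add: c_def hweight_component)
      moreover have "const k * c = scale (\<lambda>_. k) c" for k
        by (induction c rule: poly_mapping_single_induct)
          (simp_all add: const_mult_single scale_single scale_add distrib_left)
      ultimately show "Poly_Mapping.lookup (scale (P12_character q) c) w =
          Poly_Mapping.lookup (const (of_real (q powi (2 * pairing (v - ?u) ?u))) * c) w"
        by (cases "w \<in> Poly_Mapping.keys c")
          (simp_all add: lookup_scale P12_character_def homogeneous_def in_keys_iff)
    qed
    then have "gen P12 * scale (P12_character q) c \<in> rel_ideal q"
      using rel_ideal_left[OF c] by (simp add: gen_const)
    then have "c * gen P12 \<in> rel_ideal q"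
      using eqv_rel_ideal[OF eqv_mult_P12[OF assms]] by blast
    then show "component v (p * gen P12) \<in> rel_ideal q"
      by (simp add: component_mult_hweight[OF hweight_gen] c_def)
  qed
qed

section \<open>The involution on the quotient\<close>

lemma free_star_rel_ideal:
  assumes "0 < q" "x \<in> rel_ideal q"
  shows "free_star q x \<in> rel_ideal q"
  using assms(2)
proof (induction x rule: rel_ideal_induct)
  case (relation r)
  then consider g h where
    "r = gen g * gen h - const (of_real (q powi (2 * pairing (gen_weight g) (gen_weight h)))) * (gen h * gen g)"
    | "r = gen P12 * gen P34 - const (of_real (inverse q)) * (gen P13 * gen P24) + const (of_real q) * (gen P23 * gen P14)"
    unfolding relations_def q_coeff_prod[OF assms(1)] by blast
  then show ?case
  proof cases
    case 1
    let ?c = "const (of_real (q powi (2 * pairing (gen_weight g) (gen_weight h))))"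
    \<comment> \<open>The star of the relation for \<open>g\<close>, \<open>h\<close> is a scalar
      multiple of the relation for \<open>conj_gen h\<close>, \<open>conj_gen g\<close>, with the
      same power of \<open>q\<close>.\<close>
    have "gen (conj_gen h) * gen (conj_gen g) - ?c * (gen (conj_gen g) * gen (conj_gen h)) \<in> rel_ideal q"
      using eqv_gens[OF assms(1), of "conj_gen h" "conj_gen g"] by (simp add: eqv_def pairing_conj_gen)
    then have "const (of_real (conj_coeff q g)) * (const (of_real (conj_coeff q h)) *
        (gen (conj_gen h) * gen (conj_gen g) - ?c * (gen (conj_gen g) * gen (conj_gen h)))) \<in> rel_ideal q"
      by (intro rel_ideal_left)
    also have "const (of_real (conj_coeff q g)) * (const (of_real (conj_coeff q h)) *
        (gen (conj_gen h) * gen (conj_gen g) - ?c * (gen (conj_gen g) * gen (conj_gen h)))) = free_star q r"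
      unfolding 1 free_star_diff free_star_mult free_star_gen free_star_const gen_star_eq
      by (simp add: right_diff_distrib left_diff_distrib mult.assoc gen_const const_const const_mult[symmetric] mult_ac)
    finally show ?thesis .
  next
    case 2
    \<comment> \<open>The star fixes the terms with P13 P24 and P23 P14, as the coefficients of each
      conjugate pair cancel. It changes only P12 P34 into P34 P12, so the starred relation differs
      from the relation by a commutator.\<close>
    have "gen P34 * gen P12 - gen P12 * gen P34 \<in> rel_ideal q"
      using eqv_sym[OF eqv_mult_P34[OF assms(1), of "gen P12"]] by (simp add: eqv_def)
    moreover have "r \<in> rel_ideal q" using relation relations_subset_rel_ideal by blast
    ultimately have "gen P34 * gen P12 - gen P12 * gen P34 + r \<in> rel_ideal q"
      by (rule rel_ideal_add)
    also have "gen P34 * gen P12 - gen P12 * gen P34 + r = free_star q r"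
      unfolding 2 free_star_diff free_star_add free_star_mult free_star_gen free_star_const gen_star_eq
      using assms(1) by (simp add: mult.assoc gen_const const_const const_mult[symmetric])
    finally show ?thesis .
  qed
qed (auto simp: free_star_add free_star_mult intro: rel_ideal_add rel_ideal_left rel_ideal_right)

text \<open>Stability of the ideal gives one inclusion; the image is the full coset because
  \<open>free_star q\<close> is its own inverse.\<close>

lemma Gr_star_cls:
  assumes "0 < q"
  shows "Gr_star q (cls q p) = cls q (free_star q p)"
proof (intro Set.set_eqI iffI)
    fix x assume "x \<in> Gr_star q (cls q p)"
    then show "x \<in> cls q (free_star q p)"
      using free_star_rel_ideal[OF assms] by (auto simp: Gr_star_def mem_cls_iff free_star_diff[symmetric])
  next
    fix x assume "x \<in> cls q (free_star q p)"
    then have "free_star q (x - free_star q p) \<in> rel_ideal q"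
      using free_star_rel_ideal[OF assms] by (simp add: mem_cls_iff)
    then have "free_star q x \<in> cls q p"
      using assms by (simp add: mem_cls_iff free_star_diff free_star_free_star)
    moreover have "x = free_star q (free_star q x)"
      using assms by (simp add: free_star_free_star)
    ultimately show "x \<in> Gr_star q (cls q p)"
      unfolding Gr_star_def by blast
qed

subsection \<open>Fractions of Pluecker polynomials\<close>

text \<open>Transfers the ring axioms between records that share their ring operations but differ in
  type or in the star and weight fields.\<close>

lemma ring_cong:
  fixes R :: "('a, 'm) ring_scheme" and R' :: "('a, 'n) ring_scheme"
  assumes "ring R" and eq: "carrier R' = carrier R" "monoid.mult R' = monoid.mult R" "add R' = add R"
    "one R' = one R" "ring.zero R' = ring.zero R"
  shows "ring R'"
proof -
  interpret ring R by fact
  show ?thesis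
  proof (rule ringI)
    show "abelian_group R'"
      by (rule abelian_groupI) (auto simp: eq add.m_ac intro: l_neg)
  qed (auto simp: eq m_assoc l_distr r_distr intro!: monoidI)
qed

definition denom :: "nat \<Rightarrow> nat \<Rightarrow> free_alg" where
  "denom m n = gen P12 ^ m * gen P34 ^ n"

lemma denom_0 [simp]: "denom 0 0 = 1"
  by (simp add: denom_def)

lemma hdegree_power: "hdegree k p \<Longrightarrow> hdegree (n * k) (p ^ n)"
proof (induction n)
  case 0
  then show ?case by (simp add: hdegree_one)
next
  case (Suc n)
  then show ?case using hdegree_mult[of k p "n * k" "p ^ n"] by simp
qed

lemma hdegree_denom: "hdegree (m + n) (denom m n)"
  using hdegree_mult[OF hdegree_power[OF hdegree_gen, of m P12] hdegree_power[OF hdegree_gen, of n P34]]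
  by (simp add: denom_def)

lemma hweight_denom: "hweight (int m, int m) (denom m n)"
proof -
  have "hweight (int m, int m) (gen P12 ^ m)"
  proof (induction m)
    case 0
    then show ?case using hweight_one by (simp add: zero_prod_def)
  next
    case (Suc m)
    then show ?case using hweight_mult[OF hweight_gen[of P12] Suc] by (simp add: gen_weight_def)
  qed
  moreover have "hweight 0 (gen P34 ^ n)"
  proof (induction n)
    case 0
    then show ?case using hweight_one by simp
  next
    case (Suc n)
    then show ?case using hweight_mult[OF hweight_gen[of P34] Suc] by (simp add: gen_weight_def zero_prod_def)
  qed
  ultimately show ?thesis
    using hweight_mult[of "(int m, int m)" "gen P12 ^ m" 0 "gen P34 ^ n"] by (simp add: denom_def)
qed

lemma cls_denom: "cls q (denom m n) = \<Lambda> q P12 [^]\<^bsub>Gr q\<^esub> m \<otimes>\<^bsub>Gr q\<^esub> \<Lambda> q P34 [^]\<^bsub>Gr q\<^esub> n"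
  by (simp add: denom_def \<Lambda>_def cls_pow Gr_simps)

lemma denominators_eq: "denominators q = {cls q (denom m n) | m n. True}"
  by (simp add: denominators_def cls_denom)

section \<open>The denominator set and explicit fractions\<close>

context
  fixes q :: real
  assumes q_pos: "0 < q"
begin

lemma eqv_mult_P34_power: "eqv q (p * gen P34 ^ n) (gen P34 ^ n * p)"
proof (induction n)
  case (Suc n)
  have "eqv q (p * gen P34 * gen P34 ^ n) (gen P34 * p * gen P34 ^ n)"
    by (rule eqv_right[OF eqv_mult_P34[OF q_pos]])
  also have "\<dots> = gen P34 * (p * gen P34 ^ n)" by (simp add: mult.assoc)
  also have "eqv q \<dots> (gen P34 * (gen P34 ^ n * p))" by (rule eqv_left[OF Suc])
  finally show ?case by (simp add: mult.assoc)
qed simp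

lemma eqv_denom_mult: "eqv q (denom m n * denom k l) (denom (m + k) (n + l))"
proof -
  have "denom m n * denom k l = gen P12 ^ m * (gen P34 ^ n * gen P12 ^ k) * gen P34 ^ l"
    by (simp add: denom_def mult.assoc)
  also have "eqv q \<dots> (gen P12 ^ m * (gen P12 ^ k * gen P34 ^ n) * gen P34 ^ l)"
    by (intro eqv_right eqv_left eqv_sym[OF eqv_mult_P34_power])
  also have "\<dots> = denom (m + k) (n + l)"
    by (simp add: denom_def mult.assoc power_add)
  finally show ?thesis .
qed

lemma cls_denom_mult: "cls q (denom m n * denom k l) = cls q (denom (m + k) (n + l))"
  by (simp add: cls_eq_iff eqv_denom_mult)

lemma normal_denom: "normal_element q (denom m n)"
  unfolding denom_def
  by (intro normal_element_mult normal_element_power normal_element_P12 normal_element_P34 q_pos)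

lemma eqv_free_star_denom: "eqv q (free_star q (denom m n)) (denom m n)"
proof -
  have 1: "free_star q 1 = 1" using free_star_const[of q 1] by simp
  have "free_star q (gen P12 ^ m) = gen P12 ^ m" for m
    by (induction m) (simp_all add: 1 free_star_mult free_star_gen gen_star_def power_commutes)
  moreover have "free_star q (gen P34 ^ n) = gen P34 ^ n" for n
    by (induction n) (simp_all add: 1 free_star_mult free_star_gen gen_star_def power_commutes)
  ultimately show ?thesis
    by (simp add: denom_def free_star_mult eqv_sym[OF eqv_mult_P34_power])
qed

lemma star_denominators: "star_denominators (Gr q) (denominators q) (Gr_star q)"
proof -
  interpret ring "Gr q" by (rule ring_Gr)
  show ?thesis
  proof (unfold_locales, goal_cases)
    case 1
    then show ?case by (auto simp: denominators_eq Gr_simps)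
  next
    case 2
    have "cls q (denom 0 0) = \<one>\<^bsub>Gr q\<^esub>" by (simp add: Gr_simps)
    then show ?case unfolding denominators_eq by blast
  next
    case 3
    then show ?case by (clarsimp simp: denominators_eq Gr_simps cls_denom_mult) blast
  next
    case 4
    then show ?case by (auto simp: denominators_eq Gr_simps cls_denom_mult add.commute)
  next
    \<comment> \<open>Goals 5, 6 and 11 are \<open>normal\<close>, \<open>reversible\<close> and
      \<open>st_S\<close>; goals 7 to 10 are the algebraic laws of the involution.\<close>
    case (5 s a)
    then obtain m n p where *: "s = cls q (denom m n)" "a = cls q p"
      by (auto simp: denominators_eq Gr_simps)
    obtain r where "eqv q (p * denom m n) (denom m n * r)"
      using normal_denom[of m n] unfolding normal_element_def by blast
    then show ?case
      unfolding * by (intro bexI[of _ "cls q r"]) (auto simp: Gr_simps cls_eq_iff)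
  next
    case (6 s x)
    then obtain m n p where *: "s = cls q (denom m n)" "x = cls q p"
      by (auto simp: denominators_eq Gr_simps)
    then show ?case
      using 6 normal_denom[of m n] by (simp add: Gr_simps cls_eq_iff eqv_0_iff normal_element_def)
  next
    case (11 s)
    then obtain m n where "s = cls q (denom m n)" by (auto simp: denominators_eq)
    then show ?case by (simp only: Gr_star_cls[OF q_pos] cls_eq_iff eqv_free_star_denom)
  qed (use q_pos in \<open>auto simp: Gr_simps Gr_star_cls free_star_free_star free_star_add free_star_mult\<close>)
qed

interpretation Gr: star_denominators "Gr q" "denominators q" "Gr_star q"
  by (rule star_denominators)

text \<open>Keeping a polynomial and two exponents makes both gradings visible: the denominator has
  degree m + n and weight (m, m).\<close>

definition loc_frac :: "free_alg \<Rightarrow> nat \<Rightarrow> nat \<Rightarrow> loc" where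
  "loc_frac p m n = Gr_frac q (cls q p) (cls q (denom m n))"

lemma Gr_loc_simps:
  "carrier (Gr_loc q) = carrier (loc_ring q)"
  "monoid.mult (Gr_loc q) = monoid.mult (loc_ring q)"
  "add (Gr_loc q) = add (loc_ring q)"
  "one (Gr_loc q) = one (loc_ring q)"
  "ring.zero (Gr_loc q) = ring.zero (loc_ring q)"
  "module.smult (Gr_loc q) c x = emb q (cls q (const c)) \<otimes>\<^bsub>loc_ring q\<^esub> x"
  "star (Gr_loc q) = Gr.fraction_star"
  by (simp_all add: Gr_loc_def Gr.fraction_star_def[abs_def] emb_def Gr_frac_def loc_ring_def)

lemma ring_Gr_loc: "ring (Gr_loc q)"
  by (rule ring_cong[OF Gr.localization_ring]) (simp_all add: Gr_loc_simps loc_ring_def)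

interpretation Loc: ring "Gr_loc q"
  by (rule ring_Gr_loc)

lemma inv_Gr_loc: "inv\<^bsub>Gr_loc q\<^esub> x = inv\<^bsub>loc_ring q\<^esub> x"
  by (simp add: m_inv_def Gr_loc_simps)

lemma cls_in_carrier [simp]: "cls q p \<in> carrier (Gr q)"
  by (simp add: Gr_simps)

lemma denom_in_denominators [simp]: "cls q (denom m n) \<in> denominators q"
  by (auto simp: denominators_eq)

lemmas Gr_ops = Gr_simps(2-5)

lemma loc_frac_closed [simp]: "loc_frac p m n \<in> carrier (Gr_loc q)"
  by (simp add: loc_frac_def Gr_frac_def Gr_loc_simps loc_ring_def)

lemma Gr_locE:
  assumes "x \<in> carrier (Gr_loc q)"
  obtains p m n where "x = loc_frac p m n"
proof -
  have "x \<in> carrier (ore_localization (Gr q) (denominators q))"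
    using assms by (simp add: Gr_loc_simps loc_ring_def)
  then obtain a s where "a \<in> carrier (Gr q)" "s \<in> denominators q" "x = Gr.fraction a s"
    by (rule Gr.localizationE)
  then show thesis
    using that by (auto simp: Gr_simps denominators_eq loc_frac_def Gr_frac_def)
qed

lemma loc_frac_cong: "eqv q p r \<Longrightarrow> loc_frac p m n = loc_frac r m n"
  by (simp add: loc_frac_def cls_eq_iff[symmetric])

lemma loc_frac_expand: "loc_frac (p * denom k l) (m + k) (n + l) = loc_frac p m n"
  using Gr.fraction_expand[of "cls q p" "cls q (denom m n)" "cls q (denom k l)"]
  by (simp add: loc_frac_def Gr_frac_def Gr_ops cls_denom_mult)

text \<open>The factor \<open>denom k l\<close> accounts for possible torsion of \<open>Gr q\<close>
  at the denominators.\<close>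

lemma loc_frac_eq_iff: "loc_frac p m n = loc_frac r m n \<longleftrightarrow> (\<exists>k l. (p - r) * denom k l \<in> rel_ideal q)"
proof
  assume "loc_frac p m n = loc_frac r m n"
  then obtain w where w: "w \<in> denominators q"
    "cls q p \<otimes>\<^bsub>Gr q\<^esub> (cls q (denom m n) \<otimes>\<^bsub>Gr q\<^esub> w) = cls q r \<otimes>\<^bsub>Gr q\<^esub> (cls q (denom m n) \<otimes>\<^bsub>Gr q\<^esub> w)"
    by (auto simp: loc_frac_def Gr_frac_def Gr.fraction_eq_iff)
  then obtain k l where "w = cls q (denom k l)" by (auto simp: denominators_eq)
  with w have "eqv q (p * (denom m n * denom k l)) (r * (denom m n * denom k l))"
    by (simp add: Gr_ops cls_eq_iff)
  then have "(p - r) * (denom m n * denom k l) \<in> rel_ideal q"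
    by (simp add: eqv_def left_diff_distrib)
  then have "(p - r) * denom (m + k) (n + l) \<in> rel_ideal q"
    using eqv_rel_ideal[OF eqv_left[OF eqv_denom_mult]] by blast
  then show "\<exists>k l. (p - r) * denom k l \<in> rel_ideal q" by blast
next
  assume "\<exists>k l. (p - r) * denom k l \<in> rel_ideal q"
  then obtain k l where "(p - r) * denom k l \<in> rel_ideal q" by blast
  then have "eqv q (p * denom k l) (r * denom k l)" by (simp add: eqv_def left_diff_distrib)
  then show "loc_frac p m n = loc_frac r m n" using loc_frac_cong loc_frac_expand by metis
qed

lemma loc_frac_mult:
  assumes "eqv q (p' * denom m n) (denom m n * r)"
  shows "loc_frac p m n \<otimes>\<^bsub>Gr_loc q\<^esub> loc_frac p' m' n' = loc_frac (p * r) (m' + m) (n' + n)"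
  using assms Gr.localization_mult[of "cls q p" "cls q (denom m n)" "cls q (denom m' n')" "cls q p'" "cls q r"
      "cls q (denom m n)"]
  by (simp add: loc_frac_def Gr_frac_def Gr_ops cls_denom_mult cls_eq_iff Gr_loc_simps loc_ring_def)

lemma loc_frac_add: "loc_frac p m n \<oplus>\<^bsub>Gr_loc q\<^esub> loc_frac r m n = loc_frac (p + r) m n"
  using Gr.localization_add_same[of "cls q p" "cls q (denom m n)" "cls q r"]
  by (simp add: loc_frac_def Gr_frac_def Gr_ops Gr_loc_simps loc_ring_def)

lemma loc_frac_zero: "loc_frac 0 m n = \<zero>\<^bsub>Gr_loc q\<^esub>"
  using Gr.fraction_zero[of "cls q (denom m n)"]
  by (simp add: loc_frac_def Gr_frac_def Gr_ops Gr_loc_simps loc_ring_def)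

lemma loc_frac_one: "loc_frac 1 0 0 = \<one>\<^bsub>Gr_loc q\<^esub>"
  using Gr.localization_one
  by (simp add: loc_frac_def Gr_frac_def Gr_ops Gr_loc_simps loc_ring_def)

lemma loc_frac_uminus: "\<ominus>\<^bsub>Gr_loc q\<^esub> loc_frac p m n = loc_frac (- p) m n"
  by (rule Loc.minus_equality) (simp_all add: loc_frac_add loc_frac_zero)

lemma emb_cls: "emb q (cls q p) = loc_frac p 0 0"
  by (simp add: emb_def loc_frac_def Gr_ops)

lemma inv_emb_denom: "inv\<^bsub>Gr_loc q\<^esub> (emb q (cls q (denom m n))) = loc_frac 1 m n"
  using Gr.localization_inv[of "cls q (denom m n)"]
  by (simp add: emb_def loc_frac_def Gr_frac_def Gr_ops inv_Gr_loc loc_ring_def)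

lemma loc_frac_smult: "c \<odot>\<^bsub>Gr_loc q\<^esub> loc_frac p m n = loc_frac (const c * p) m n"
  using loc_frac_mult[of p 0 0 p "const c" m n]
  by (simp add: Gr_loc_simps emb_cls)

lemma loc_frac_star:
  assumes "eqv q (free_star q p * denom m n) (denom m n * r)"
  shows "star (Gr_loc q) (loc_frac p m n) = loc_frac r m n"
  using assms Gr.fraction_star_eq[of "cls q p" "cls q (denom m n)" "cls q r"] q_pos
  by (simp add: loc_frac_def Gr_frac_def Gr_ops Gr_loc_simps Gr_star_cls cls_eq_iff)

lemma commute_denomE:
  obtains r where "Poly_Mapping.keys r \<subseteq> Poly_Mapping.keys p" "eqv q (p * denom m n) (denom m n * r)"
  using normal_denom[of m n] unfolding normal_element_def by blast

lemma loc_frac_add_cross: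
  "loc_frac p m n \<oplus>\<^bsub>Gr_loc q\<^esub> loc_frac p' m' n' = loc_frac (p * denom m' n' + p' * denom m n) (m + m') (n + n')"
  using loc_frac_expand[of p m' n' m n] loc_frac_expand[of p' m n m' n']
  by (simp add: add.commute flip: loc_frac_add)

section \<open>The subring of degree zero\<close>

definition degree_zero :: "loc set" where
  "degree_zero = {loc_frac p m n | p m n. hdegree (m + n) p}"

lemma loc_frac_degree_zero: "hdegree (m + n) p \<Longrightarrow> loc_frac p m n \<in> degree_zero"
  unfolding degree_zero_def by blast

lemma degree_zeroE:
  assumes "x \<in> degree_zero"
  obtains p m n where "hdegree (m + n) p" "x = loc_frac p m n"
  using assms unfolding degree_zero_def by blast

lemma degree_zero_carrier: "degree_zero \<subseteq> carrier (Gr_loc q)"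
  by (auto elim: degree_zeroE)

lemma degree_zero_add:
  assumes "x \<in> degree_zero" "y \<in> degree_zero"
  shows "x \<oplus>\<^bsub>Gr_loc q\<^esub> y \<in> degree_zero"
proof -
  obtain p m n where p: "hdegree (m + n) p" "x = loc_frac p m n" using assms degree_zeroE by metis
  obtain p' m' n' where p': "hdegree (m' + n') p'" "y = loc_frac p' m' n'" using assms degree_zeroE by metis
  have "hdegree (m + m' + (n + n')) (p * denom m' n')"
    using hdegree_mult[OF p(1) hdegree_denom[of m' n']] by (simp add: ac_simps)
  moreover have "hdegree (m + m' + (n + n')) (p' * denom m n)"
    using hdegree_mult[OF p'(1) hdegree_denom[of m n]] by (simp add: ac_simps)
  ultimately have "hdegree (m + m' + (n + n')) (p * denom m' n' + p' * denom m n)"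
    by (rule homogeneous_add)
  then show ?thesis
    unfolding p p' loc_frac_add_cross by (rule loc_frac_degree_zero)
qed

lemma degree_zero_mult:
  assumes "x \<in> degree_zero" "y \<in> degree_zero"
  shows "x \<otimes>\<^bsub>Gr_loc q\<^esub> y \<in> degree_zero"
proof -
  obtain p m n where p: "hdegree (m + n) p" "x = loc_frac p m n" using assms degree_zeroE by metis
  obtain p' m' n' where p': "hdegree (m' + n') p'" "y = loc_frac p' m' n'" using assms degree_zeroE by metis
  obtain r where r: "Poly_Mapping.keys r \<subseteq> Poly_Mapping.keys p'" "eqv q (p' * denom m n) (denom m n * r)"
    by (rule commute_denomE)
  have "hdegree (m + n + (m' + n')) (p * r)"
    using hdegree_mult[OF p(1) homogeneous_subset[OF p'(1) r(1)]] .
  then have "hdegree (m' + m + (n' + n)) (p * r)" by (simp add: ac_simps)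
  then show ?thesis
    unfolding p p' loc_frac_mult[OF r(2)] by (rule loc_frac_degree_zero)
qed

lemma degree_zero_smult: "x \<in> degree_zero \<Longrightarrow> c \<odot>\<^bsub>Gr_loc q\<^esub> x \<in> degree_zero"
  by (auto elim!: degree_zeroE simp: loc_frac_smult intro!: loc_frac_degree_zero hdegree_const_mult)

lemma degree_zero_star:
  assumes "x \<in> degree_zero"
  shows "star (Gr_loc q) x \<in> degree_zero"
proof -
  obtain p m n where p: "hdegree (m + n) p" "x = loc_frac p m n" using assms degree_zeroE by metis
  obtain r where r: "Poly_Mapping.keys r \<subseteq> Poly_Mapping.keys (free_star q p)"
    "eqv q (free_star q p * denom m n) (denom m n * r)"
    by (rule commute_denomE)
  show ?thesis
    unfolding p loc_frac_star[OF r(2)]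
    using homogeneous_subset[OF hdegree_free_star[OF p(1)] r(1)] by (rule loc_frac_degree_zero)
qed

lemma subring_degree_zero: "subring degree_zero (Gr_loc q)"
proof (rule Loc.subringI)
  show "\<one>\<^bsub>Gr_loc q\<^esub> \<in> degree_zero"
    using loc_frac_degree_zero[of 0 0 1] hdegree_one by (simp add: loc_frac_one)
  show "\<ominus>\<^bsub>Gr_loc q\<^esub> x \<in> degree_zero" if "x \<in> degree_zero" for x
    using that by (auto elim!: degree_zeroE simp: loc_frac_uminus intro!: loc_frac_degree_zero homogeneous_uminus)
qed (use degree_zero_carrier degree_zero_add degree_zero_mult in auto)

section \<open>Generation by each of the two charts\<close>

lemma Gr_degree_eq: "Gr_degree q n = cls q ` {p. hdegree n p}"
  by (simp add: Gr_degree_def homogeneous_def word_length_def)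

lemma cls_denom_simps:
  "\<Lambda> q P12 [^]\<^bsub>Gr q\<^esub> n = cls q (denom n 0)"
  "\<Lambda> q P34 [^]\<^bsub>Gr q\<^esub> n = cls q (denom 0 n)"
  "\<Lambda> q P12 = cls q (denom 1 0)"
  "\<Lambda> q P34 = cls q (denom 0 1)"
  by (simp_all add: denom_def \<Lambda>_def cls_pow)

lemma R4_eq: "R4 q = {loc_frac p 0 n | p n. hdegree n p}"
  unfolding R4_def Gr_degree_eq cls_denom_simps(1,2) loc_frac_def by blast

lemma inv_emb_mult_emb:
  assumes "eqv q (p * denom m n) (denom m n * r)"
  shows "inv\<^bsub>Gr_loc q\<^esub> (emb q (cls q (denom m n))) \<otimes>\<^bsub>Gr_loc q\<^esub> emb q (cls q p) = loc_frac r m n"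
  using loc_frac_mult[OF assms, of 1 0 0] by (simp only: inv_emb_denom) (simp add: emb_cls)

text \<open>Left and right fractions over a power of \<open>gen P12\<close> are exchanged by the
  twist, which preserves the degree of the numerator in either direction.\<close>

lemma R4_tilde_eq: "R4_tilde q = {loc_frac p n 0 | p n. hdegree n p}"
proof (intro subset_antisym subsetI)
  fix x assume "x \<in> R4_tilde q"
  then obtain n p where p: "hdegree n p"
    "x = inv\<^bsub>Gr_loc q\<^esub> (emb q (cls q (denom n 0))) \<otimes>\<^bsub>Gr_loc q\<^esub> emb q (cls q p)"
    unfolding R4_tilde_def Gr_degree_eq cls_denom_simps(1,2) by blast
  obtain r where r: "Poly_Mapping.keys r \<subseteq> Poly_Mapping.keys p" "eqv q (p * denom n 0) (denom n 0 * r)"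
    by (rule commute_denomE)
  then show "x \<in> {loc_frac p n 0 | p n. hdegree n p}"
    using p homogeneous_subset[OF p(1) r(1)] inv_emb_mult_emb[OF r(2)] by blast
next
  fix x assume "x \<in> {loc_frac p n 0 | p n. hdegree n p}"
  then obtain p n where p: "hdegree n p" "x = loc_frac p n 0" by blast
  obtain r where r: "Poly_Mapping.keys r \<subseteq> Poly_Mapping.keys p" "eqv q (denom n 0 * p) (r * denom n 0)"
    using normal_denom[of n 0] unfolding normal_element_def by blast
  have "x = inv\<^bsub>Gr_loc q\<^esub> (emb q (cls q (denom n 0))) \<otimes>\<^bsub>Gr_loc q\<^esub> emb q (cls q r)"
    using p inv_emb_mult_emb[OF eqv_sym[OF r(2)]] by simp
  then show "x \<in> R4_tilde q"
    unfolding R4_tilde_def Gr_degree_eq cls_denom_simps(1,2)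
    using homogeneous_subset[OF p(1) r(1)] by blast
qed

lemma rho_eq: "rho q = loc_frac (const (of_real q) * gen P12) 0 1"
  using loc_frac_mult[of 1 0 0 1 "gen P12" 0 1]
  unfolding rho_def cls_denom_simps(3,4) inv_emb_denom by (simp add: emb_cls loc_frac_smult denom_def)

lemma rho_tilde_eq: "rho_tilde q = loc_frac (const (of_real q) * gen P34) 1 0"
proof -
  have "eqv q (denom 0 1 * denom 1 0) (denom 1 0 * gen P34)"
    using eqv_denom_mult[of 0 1 1 0] by (simp add: denom_def)
  from inv_emb_mult_emb[OF this] show ?thesis
    unfolding rho_tilde_def cls_denom_simps(3,4) by (simp add: loc_frac_smult)
qed

lemma loc_frac_mult_const: "loc_frac (const c) 0 0 \<otimes>\<^bsub>Gr_loc q\<^esub> loc_frac p m n = loc_frac (const c * p) m n"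
  using loc_frac_mult[of p 0 0 p "const c" m n] by simp

text \<open>Induction on the exponent of P12: a fraction over P12^{m+1} P34^n is the fraction with
  the same numerator over P12^m P34^{n+1}, times P34 P12^{-1}. The total degree of the denominator
  is unchanged, so the induction hypothesis applies.\<close>

lemma generate_R4: "generate_ring (Gr_loc q) (insert (rho_tilde q) (R4 q)) = degree_zero"
proof -
  let ?G = "generate_ring (Gr_loc q) (insert (rho_tilde q) (R4 q))"
  have sub: "insert (rho_tilde q) (R4 q) \<subseteq> degree_zero"
    using loc_frac_degree_zero[of 1 0] hdegree_const_mult[OF hdegree_gen] loc_frac_degree_zero[of 0]
    by (auto simp: R4_eq rho_tilde_eq)
  have R4: "loc_frac p 0 n \<in> ?G" if "hdegree n p" for p n
    using that by (intro generate_ring.incl) (auto simp: R4_eq)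
  \<comment> \<open>Scalars are fractions of degree zero with trivial denominator, so they lie in
    the chart and the factor \<open>q\<close> in \<open>rho_tilde\<close> can be removed.\<close>
  have "loc_frac (const (of_real (inverse q))) 0 0 \<otimes>\<^bsub>Gr_loc q\<^esub> rho_tilde q \<in> ?G"
    by (intro generate_ring.eng_mult R4 hdegree_const) (auto intro: generate_ring.incl)
  then have P34: "loc_frac (gen P34) 1 0 \<in> ?G"
    using q_pos by (simp add: rho_tilde_eq loc_frac_mult_const const_const)
  have "loc_frac p m n \<in> ?G" if "hdegree (m + n) p" for p m n
    using that
  proof (induction m arbitrary: n)
    case 0
    then show ?case by (simp add: R4)
  next
    case (Suc m)
    then have "loc_frac p m (Suc n) \<otimes>\<^bsub>Gr_loc q\<^esub> loc_frac (gen P34) 1 0 \<in> ?G"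
      by (intro generate_ring.eng_mult P34) simp
    moreover have "eqv q (gen P34 * denom m (Suc n)) (denom m (Suc n) * gen P34)"
      by (rule eqv_sym[OF eqv_mult_P34[OF q_pos]])
    note loc_frac_mult[OF this, of p 1 0]
    moreover have "loc_frac (p * gen P34) (1 + m) (0 + Suc n) = loc_frac p (Suc m) n"
      using loc_frac_expand[of p 0 1 "Suc m" n] by (simp add: denom_def)
    ultimately show ?case by simp
  qed
  then have "degree_zero \<subseteq> ?G" by (auto elim: degree_zeroE)
  moreover have "?G \<subseteq> degree_zero"
    using sub degree_zero_carrier by (intro Loc.generate_ring_min_subring1[OF _ subring_degree_zero]) auto
  ultimately show ?thesis by blast
qed

lemma generate_R4_tilde: "generate_ring (Gr_loc q) (insert (rho q) (R4_tilde q)) = degree_zero"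
proof -
  let ?G = "generate_ring (Gr_loc q) (insert (rho q) (R4_tilde q))"
  have sub: "insert (rho q) (R4_tilde q) \<subseteq> degree_zero"
    using loc_frac_degree_zero[of 0 1] hdegree_const_mult[OF hdegree_gen] loc_frac_degree_zero[of _ 0]
    by (auto simp: R4_tilde_eq rho_eq)
  have R4: "loc_frac p n 0 \<in> ?G" if "hdegree n p" for p n
    using that by (intro generate_ring.incl) (auto simp: R4_tilde_eq)
  have "loc_frac (const (of_real (inverse q))) 0 0 \<otimes>\<^bsub>Gr_loc q\<^esub> rho q \<in> ?G"
    by (intro generate_ring.eng_mult R4 hdegree_const) (auto intro: generate_ring.incl)
  then have P12: "loc_frac (gen P12) 0 1 \<in> ?G"
    using q_pos by (simp add: rho_eq loc_frac_mult_const const_const)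
  have "loc_frac p m n \<in> ?G" if "hdegree (m + n) p" for p m n
    using that
  proof (induction n arbitrary: m)
    case 0
    then show ?case by (simp add: R4)
  next
    case (Suc n)
    then have mem: "loc_frac p (Suc m) n \<otimes>\<^bsub>Gr_loc q\<^esub> loc_frac (gen P12) 0 1 \<in> ?G"
      by (intro generate_ring.eng_mult P12) simp
    \<comment> \<open>Although \<open>gen P12\<close> is not central, it commutes with denominators:
      both orders of the product reduce to the same \<open>denom\<close>.\<close>
    have "eqv q (denom 1 0 * denom (Suc m) n) (denom (1 + Suc m) (0 + n))"
      by (rule eqv_denom_mult)
    also have "\<dots> = denom (Suc m + 1) (n + 0)" by simp
    also have "eqv q \<dots> (denom (Suc m) n * denom 1 0)"
      by (rule eqv_sym[OF eqv_denom_mult])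
    finally have "eqv q (denom 1 0 * denom (Suc m) n) (denom (Suc m) n * denom 1 0)" .
    then have "eqv q (gen P12 * denom (Suc m) n) (denom (Suc m) n * gen P12)"
      by (simp add: denom_def)
    note loc_frac_mult[OF this, of p 0 1]
    moreover have "loc_frac (p * gen P12) (0 + Suc m) (1 + n) = loc_frac p m (Suc n)"
      using loc_frac_expand[of p 1 0 m "Suc n"] by (simp add: denom_def)
    ultimately show ?case using mem by simp
  qed
  then have "degree_zero \<subseteq> ?G" by (auto elim: degree_zeroE)
  moreover have "?G \<subseteq> degree_zero"
    using sub degree_zero_carrier by (intro Loc.generate_ring_min_subring1[OF _ subring_degree_zero]) auto
  ultimately show ?thesis by blast
qed

section \<open>Weights of fractions\<close>

lemma Gr_wt_eq: "Gr_wt q v = cls q ` {p. hweight v p}"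
  by (simp add: Gr_wt_def homogeneous_def)

text \<open>
  If \<open>Gr q\<close> were trivial, a denominator would have every weight; then all fractions vanish, so
  the numerator \<open>0\<close> can be chosen.
\<close>

lemma wt_Gr_loc_iff:
  "x \<in> wt (Gr_loc q) w \<longleftrightarrow> (\<exists>p m n. hweight (w + (int m, int m)) p \<and> x = loc_frac p m n)"
proof
  assume "x \<in> wt (Gr_loc q) w"
  then obtain a s u v where *: "x = Gr_frac q a s" "a \<in> Gr_wt q u" "s \<in> denominators q" "s \<in> Gr_wt q v" "w = u - v"
    by (auto simp: Gr_loc_def)
  then obtain p d m n where p: "hweight u p" "a = cls q p" and d: "hweight v d" "s = cls q d" "s = cls q (denom m n)"
    by (auto simp: Gr_wt_eq denominators_eq)
  have x: "x = loc_frac p m n" using * p d by (simp add: loc_frac_def)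
  show "\<exists>p m n. hweight (w + (int m, int m)) p \<and> x = loc_frac p m n"
  proof (cases "v = (int m, int m)")
    case True
    then have "w + (int m, int m) = u" using * by simp
    then show ?thesis using x p(1) by blast
  next
    case False
    have "cls q d = cls q (denom m n)" using d(2,3) by metis
    then have "d - denom m n \<in> rel_ideal q" by (simp add: cls_eq_iff eqv_def)
    then have "component v (d - denom m n) \<in> rel_ideal q" by (rule component_rel_ideal)
    moreover have "component v (d - denom m n) = component v d + component v (- denom m n)"
      using component_add[of v d "- denom m n"] by simp
    ultimately have "d \<in> rel_ideal q"
      using False d(1) by (simp add: component_hweight component_hweight[OF homogeneous_uminus[OF hweight_denom]])
    then have "denom m n \<in> rel_ideal q"
      using rel_ideal_diff[of d q "d - denom m n"] \<open>d - denom m n \<in> rel_ideal q\<close> by simp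
    then have "(p - 0) * denom m n \<in> rel_ideal q" by (rule rel_ideal_left)
    then have "loc_frac p m n = loc_frac 0 m n" unfolding loc_frac_eq_iff by blast
    with x show ?thesis by (metis homogeneous_0)
  qed
next
  assume "\<exists>p m n. hweight (w + (int m, int m)) p \<and> x = loc_frac p m n"
  then obtain p m n where "hweight (w + (int m, int m)) p" "x = loc_frac p m n" by blast
  then have "x = Gr_frac q (cls q p) (cls q (denom m n)) \<and> cls q p \<in> Gr_wt q (w + (int m, int m)) \<and>
      cls q (denom m n) \<in> denominators q \<and> cls q (denom m n) \<in> Gr_wt q (int m, int m) \<and>
      w = w + (int m, int m) - (int m, int m)"
    using hweight_denom[of m n] by (auto simp: loc_frac_def Gr_wt_eq)
  then have "\<exists>a s u v. x = Gr_frac q a s \<and> a \<in> Gr_wt q u \<and> s \<in> denominators q \<and> s \<in> Gr_wt q v \<and> w = u - v"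
    by (intro exI)
  then show "x \<in> wt (Gr_loc q) w"
    unfolding Gr_loc_def by simp
qed

text \<open>Expanding by \<open>denom (M - m) (N - n)\<close> shifts the weights of numerator and
  denominator alike. All sufficiently large exponents are allowed, so that several homogeneous
  fractions can be put over one denominator.\<close>

lemma wt_raise:
  assumes "x \<in> wt (Gr_loc q) w"
  obtains m n where "\<And>M N. m \<le> M \<Longrightarrow> n \<le> N \<Longrightarrow> \<exists>p. hweight (w + (int M, int M)) p \<and> x = loc_frac p M N"
proof -
  obtain p m n where p: "hweight (w + (int m, int m)) p" "x = loc_frac p m n"
    using assms by (auto simp: wt_Gr_loc_iff)
  show thesis
  proof (rule that[of m n])
    fix M N :: nat assume le: "m \<le> M" "n \<le> N"
    have "hweight (w + (int m, int m) + (int (M - m), int (M - m))) (p * denom (M - m) (N - n))"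
      by (rule hweight_mult[OF p(1) hweight_denom])
    also have "w + (int m, int m) + (int (M - m), int (M - m)) = w + (int M, int M)"
      using le by (simp add: add.assoc)
    finally show "\<exists>p. hweight (w + (int M, int M)) p \<and> x = loc_frac p M N"
      using p loc_frac_expand[of p "M - m" "N - n" m n] le by auto
  qed
qed

lemma wt_common_denominator:
  assumes "finite W" "\<And>w. w \<in> W \<Longrightarrow> f w \<in> wt (Gr_loc q) w"
  obtains m n where "\<And>M N. m \<le> M \<Longrightarrow> n \<le> N \<Longrightarrow>
    \<exists>P. \<forall>w\<in>W. hweight (w + (int M, int M)) (P w) \<and> f w = loc_frac (P w) M N"
proof -
  have "\<exists>m n. \<forall>M N. m \<le> M \<longrightarrow> n \<le> N \<longrightarrow> (\<exists>p. hweight (w + (int M, int M)) p \<and> f w = loc_frac p M N)"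
    if "w \<in> W" for w
    using wt_raise[OF assms(2)[OF that]] by metis
  then obtain m n where mn: "\<And>w M N. \<lbrakk>w \<in> W; m w \<le> M; n w \<le> N\<rbrakk> \<Longrightarrow>
      \<exists>p. hweight (w + (int M, int M)) p \<and> f w = loc_frac p M N"
    by metis
  \<comment> \<open>Sums serve as simultaneous bounds for the exponents chosen separately at each
    weight.\<close>
  show thesis
  proof (rule that[of "\<Sum>w\<in>W. m w" "\<Sum>w\<in>W. n w"])
    fix M N assume "(\<Sum>w\<in>W. m w) \<le> M" "(\<Sum>w\<in>W. n w) \<le> N"
    then have "m w \<le> M" "n w \<le> N" if "w \<in> W" for w
      using member_le_sum[OF that, of m] member_le_sum[OF that, of n] assms(1) by auto
    then have "\<forall>w\<in>W. \<exists>p. hweight (w + (int M, int M)) p \<and> f w = loc_frac p M N"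
      using mn by blast
    then show "\<exists>P. \<forall>w\<in>W. hweight (w + (int M, int M)) (P w) \<and> f w = loc_frac (P w) M N"
      by (rule bchoice)
  qed
qed

section \<open>The weight decomposition in degree zero\<close>

definition Gr_loc_zero :: "loc star_comodule" where
  "Gr_loc_zero =
    (Gr_loc q)\<lparr>carrier := degree_zero, wt := (\<lambda>w. wt (Gr_loc q) w \<inter> degree_zero)\<rparr>"

lemma Gr_loc_zero_simps [simp]:
  "carrier Gr_loc_zero = degree_zero" "monoid.mult Gr_loc_zero = monoid.mult (Gr_loc q)" "add Gr_loc_zero = add (Gr_loc q)"
  "one Gr_loc_zero = one (Gr_loc q)" "ring.zero Gr_loc_zero = ring.zero (Gr_loc q)" "module.smult Gr_loc_zero = module.smult (Gr_loc q)"
  "star Gr_loc_zero = star (Gr_loc q)" "wt Gr_loc_zero w = wt (Gr_loc q) w \<inter> degree_zero"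
  by (simp_all add: Gr_loc_zero_def)

lemma ring_Gr_loc_zero: "ring Gr_loc_zero"
  by (rule ring_cong[OF Loc.subring_is_ring[OF subring_degree_zero]]) simp_all

interpretation A: ring Gr_loc_zero
  by (rule ring_Gr_loc_zero)

lemma finsum_loc_frac:
  assumes "finite W" "\<And>w. w \<in> W \<Longrightarrow> loc_frac (P w) m n \<in> degree_zero"
  shows "(\<Oplus>\<^bsub>Gr_loc_zero\<^esub>w\<in>W. loc_frac (P w) m n) = loc_frac (\<Sum>w\<in>W. P w) m n"
  using assms
proof (induction W)
  case (insert w W)
  then have "(\<Oplus>\<^bsub>Gr_loc_zero\<^esub>w\<in>insert w W. loc_frac (P w) m n) = loc_frac (P w) m n \<oplus>\<^bsub>Gr_loc_zero\<^esub> (\<Oplus>\<^bsub>Gr_loc_zero\<^esub>w\<in>W. loc_frac (P w) m n)"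
    by (intro A.finsum_insert) auto
  with insert show ?case by (simp add: loc_frac_add)
qed (simp add: loc_frac_zero)

lemma finsum_support:
  assumes "finite V" "{w. f w \<noteq> \<zero>\<^bsub>Gr_loc q\<^esub>} \<subseteq> V" "\<And>w. w \<in> V \<Longrightarrow> f w \<in> degree_zero"
  shows "(\<Oplus>\<^bsub>Gr_loc_zero\<^esub>w\<in>{w. f w \<noteq> \<zero>\<^bsub>Gr_loc q\<^esub>}. f w) = (\<Oplus>\<^bsub>Gr_loc_zero\<^esub>w\<in>V. f w)"
  using assms by (intro A.add.finprod_mono_neutral_cong_left) auto

lemma wt_decomposition_exists:
  assumes "x \<in> degree_zero"
  shows "\<exists>f. (\<forall>w. f w \<in> wt Gr_loc_zero w) \<and> finite {w. f w \<noteq> \<zero>\<^bsub>Gr_loc_zero\<^esub>} \<and> x = (\<Oplus>\<^bsub>Gr_loc_zero\<^esub>w\<in>{w. f w \<noteq> \<zero>\<^bsub>Gr_loc_zero\<^esub>}. f w)"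
proof -
  obtain p m n where p: "hdegree (m + n) p" "x = loc_frac p m n" using assms degree_zeroE by metis
  \<comment> \<open>The weight of the denominator: the part of \<open>x\<close> of weight
    \<open>w\<close> has the component of \<open>p\<close> of weight w + d as its numerator.\<close>
  define d where "d = (int m, int m)"
  define f where "f w = loc_frac (component (w + d) p) m n" for w
  define V where "V = (\<lambda>v. v - d) ` word_weight ` Poly_Mapping.keys p"
  have deg: "f w \<in> degree_zero" for w
    unfolding f_def using p
    by (intro loc_frac_degree_zero homogeneous_subset[OF p(1)]) (auto simp: keys_component)
  have wt: "f w \<in> wt Gr_loc_zero w" for w
    using deg hweight_component[of "w + d" p] by (auto simp: wt_Gr_loc_iff f_def d_def)
  have V: "finite V" by (simp add: V_def)
  \<comment> \<open>The inclusion can be strict, since a nonzero component may represent the zero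
    fraction; hence the later sums run over \<open>V\<close>.\<close>
  have supp: "{w. f w \<noteq> \<zero>\<^bsub>Gr_loc_zero\<^esub>} \<subseteq> V"
  proof
    fix w assume "w \<in> {w. f w \<noteq> \<zero>\<^bsub>Gr_loc_zero\<^esub>}"
    then have "component (w + d) p \<noteq> 0" by (auto simp: f_def loc_frac_zero)
    then have "Poly_Mapping.keys (component (w + d) p) \<noteq> {}" by simp
    then obtain y where "y \<in> Poly_Mapping.keys p" "word_weight y = w + d"
      unfolding keys_component by blast
    then have "w + d \<in> word_weight ` Poly_Mapping.keys p" by (metis imageI)
    then have "w + d - d \<in> V" unfolding V_def by blast
    then show "w \<in> V" by simp
  qed
  have "(\<Oplus>\<^bsub>Gr_loc_zero\<^esub>w\<in>{w. f w \<noteq> \<zero>\<^bsub>Gr_loc_zero\<^esub>}. f w) = (\<Oplus>\<^bsub>Gr_loc_zero\<^esub>w\<in>V. f w)"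
    using finsum_support[of V f] V supp deg by simp
  also have "\<dots> = loc_frac (\<Sum>w\<in>V. component (w + d) p) m n"
    unfolding f_def using V deg by (intro finsum_loc_frac) (simp_all add: f_def)
  also have "(\<Sum>w\<in>V. component (w + d) p) = (\<Sum>v\<in>word_weight ` Poly_Mapping.keys p. component v p)"
    unfolding V_def by (subst sum.reindex) (auto intro: inj_onI)
  also have "\<dots> = p" by (rule sum_components) auto
  finally have "x = (\<Oplus>\<^bsub>Gr_loc_zero\<^esub>w\<in>{w. f w \<noteq> \<zero>\<^bsub>Gr_loc_zero\<^esub>}. f w)" using p by simp
  then show ?thesis using wt finite_subset[OF supp V] by blast
qed

text \<open>Over a common denominator, equality of the two sums says that the difference of the
  summed numerators, times some \<open>denom k l\<close>, lies in the ideal. The ideal is graded and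
  the numerators for different weights have different weights, so the relation holds for each weight
  separately.\<close>

lemma wt_decomposition_unique:
  assumes f: "\<And>w. f w \<in> wt Gr_loc_zero w" "finite {w. f w \<noteq> \<zero>\<^bsub>Gr_loc_zero\<^esub>}" "x = (\<Oplus>\<^bsub>Gr_loc_zero\<^esub>w\<in>{w. f w \<noteq> \<zero>\<^bsub>Gr_loc_zero\<^esub>}. f w)"
    and g: "\<And>w. g w \<in> wt Gr_loc_zero w" "finite {w. g w \<noteq> \<zero>\<^bsub>Gr_loc_zero\<^esub>}" "x = (\<Oplus>\<^bsub>Gr_loc_zero\<^esub>w\<in>{w. g w \<noteq> \<zero>\<^bsub>Gr_loc_zero\<^esub>}. g w)"
  shows "f = g"
proof
  fix w
  \<comment> \<open>\<open>w\<close> is added so that the comparison at \<open>w\<close> covers the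
    case where both parts vanish there.\<close>
  define V where "V = insert w ({w. f w \<noteq> \<zero>\<^bsub>Gr_loc_zero\<^esub>} \<union> {w. g w \<noteq> \<zero>\<^bsub>Gr_loc_zero\<^esub>})"
  have V: "finite V" using f g by (simp add: V_def)
  obtain m n where f_denom: "\<And>M N. m \<le> M \<Longrightarrow> n \<le> N \<Longrightarrow>
      \<exists>P. \<forall>w\<in>V. hweight (w + (int M, int M)) (P w) \<and> f w = loc_frac (P w) M N"
    using wt_common_denominator[OF V, of f] f(1) by auto
  obtain m' n' where g_denom: "\<And>M N. m' \<le> M \<Longrightarrow> n' \<le> N \<Longrightarrow>
      \<exists>P. \<forall>w\<in>V. hweight (w + (int M, int M)) (P w) \<and> g w = loc_frac (P w) M N"
    using wt_common_denominator[OF V, of g] g(1) by auto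
  define M where "M = max m m'"
  define N where "N = max n n'"
  obtain F where F: "\<And>w. w \<in> V \<Longrightarrow> hweight (w + (int M, int M)) (F w) \<and> f w = loc_frac (F w) M N"
    using f_denom[of M N] by (auto simp: M_def N_def)
  obtain G where G: "\<And>w. w \<in> V \<Longrightarrow> hweight (w + (int M, int M)) (G w) \<and> g w = loc_frac (G w) M N"
    using g_denom[of M N] by (auto simp: M_def N_def)
  have F0: "loc_frac (F w) M N \<in> degree_zero" and G0: "loc_frac (G w) M N \<in> degree_zero" if "w \<in> V" for w
    using F[OF that] G[OF that] f(1)[of w] g(1)[of w] by simp_all
  have "x = (\<Oplus>\<^bsub>Gr_loc_zero\<^esub>w\<in>V. f w)"
    using finsum_support[of V f] f V by (auto simp: V_def)
  also have "\<dots> = (\<Oplus>\<^bsub>Gr_loc_zero\<^esub>w\<in>V. loc_frac (F w) M N)"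
    using F F0 by (intro A.finsum_cong) (auto simp: simp_implies_def)
  also have "\<dots> = loc_frac (\<Sum>w\<in>V. F w) M N"
    using F0 V by (intro finsum_loc_frac) auto
  finally have xF: "x = loc_frac (\<Sum>w\<in>V. F w) M N" .
  have "x = (\<Oplus>\<^bsub>Gr_loc_zero\<^esub>w\<in>V. g w)"
    using finsum_support[of V g] g V by (auto simp: V_def)
  also have "\<dots> = (\<Oplus>\<^bsub>Gr_loc_zero\<^esub>w\<in>V. loc_frac (G w) M N)"
    using G G0 by (intro A.finsum_cong) (auto simp: simp_implies_def)
  also have "\<dots> = loc_frac (\<Sum>w\<in>V. G w) M N"
    using G0 V by (intro finsum_loc_frac) auto
  finally have "loc_frac (\<Sum>w\<in>V. F w) M N = loc_frac (\<Sum>w\<in>V. G w) M N" using xF by simp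
  then obtain k l where kl: "((\<Sum>w\<in>V. F w) - (\<Sum>w\<in>V. G w)) * denom k l \<in> rel_ideal q"
    unfolding loc_frac_eq_iff by blast
  define u where "u = w + (int M, int M)"
  \<comment> \<open>The component is taken at u + (k, k) because \<open>denom k l\<close> has weight
    (k, k); dividing it off leaves the component at \<open>u\<close>, to which only the summand for
    \<open>w\<close> contributes.\<close>
  have "component (u + (int k, int k)) ((\<Sum>w\<in>V. F w - G w) * denom k l) \<in> rel_ideal q"
    using kl by (intro component_rel_ideal) (simp add: sum_subtractf)
  then have "component u (\<Sum>w\<in>V. F w - G w) * denom k l \<in> rel_ideal q"
    by (simp add: component_mult_hweight[OF hweight_denom])
  also have "component u (\<Sum>w\<in>V. F w - G w) = (\<Sum>v\<in>V. if v = w then F v - G v else 0)"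
    unfolding component_sum
  proof (intro sum.cong refl)
    fix v assume "v \<in> V"
    then have "hweight (v + (int M, int M)) (F v - G v)"
      by (intro homogeneous_diff conjunct1[OF F] conjunct1[OF G])
    moreover have "u = v + (int M, int M) \<longleftrightarrow> v = w"
      unfolding u_def add_right_cancel by (rule eq_commute)
    ultimately show "component u (F v - G v) = (if v = w then F v - G v else 0)"
      by (simp only: component_hweight)
  qed
  also have "\<dots> = F w - G w"
    using V by (simp add: V_def)
  finally have "loc_frac (F w) M N = loc_frac (G w) M N" unfolding loc_frac_eq_iff by blast
  moreover have "w \<in> V" by (simp add: V_def)
  ultimately show "f w = g w" using F G by simp
qed

section \<open>The axioms of a comodule star-algebra\<close>

lemma wt_Gr_loc_zero_add:
  assumes "x \<in> wt Gr_loc_zero w" "y \<in> wt Gr_loc_zero w"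
  shows "x \<oplus>\<^bsub>Gr_loc_zero\<^esub> y \<in> wt Gr_loc_zero w"
proof -
  obtain m n where m: "\<And>M N. m \<le> M \<Longrightarrow> n \<le> N \<Longrightarrow> \<exists>p. hweight (w + (int M, int M)) p \<and> x = loc_frac p M N"
    using wt_raise[of x w] assms by auto
  obtain m' n' where m': "\<And>M N. m' \<le> M \<Longrightarrow> n' \<le> N \<Longrightarrow> \<exists>p. hweight (w + (int M, int M)) p \<and> y = loc_frac p M N"
    using wt_raise[of y w] assms by auto
  define M where "M = max m m'"
  define N where "N = max n n'"
  obtain p where p: "hweight (w + (int M, int M)) p" "x = loc_frac p M N"
    using m[of M N] by (auto simp: M_def N_def)
  obtain r where r: "hweight (w + (int M, int M)) r" "y = loc_frac r M N"
    using m'[of M N] by (auto simp: M_def N_def)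
  have "x \<oplus>\<^bsub>Gr_loc q\<^esub> y \<in> wt (Gr_loc q) w"
    unfolding wt_Gr_loc_iff p(2) r(2) loc_frac_add using homogeneous_add[OF p(1) r(1)] by blast
  then show ?thesis using assms degree_zero_add by simp
qed

lemma wt_Gr_loc_zero_smult:
  assumes "x \<in> wt Gr_loc_zero w"
  shows "c \<odot>\<^bsub>Gr_loc_zero\<^esub> x \<in> wt Gr_loc_zero w"
proof -
  obtain p m n where p: "hweight (w + (int m, int m)) p" "x = loc_frac p m n"
    using assms by (auto simp: wt_Gr_loc_iff)
  have "c \<odot>\<^bsub>Gr_loc q\<^esub> x \<in> wt (Gr_loc q) w"
    unfolding wt_Gr_loc_iff p(2) loc_frac_smult using hweight_const_mult[OF p(1)] by blast
  then show ?thesis using assms degree_zero_smult by simp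
qed

lemma wt_Gr_loc_zero_mult:
  assumes "x \<in> wt Gr_loc_zero u" "y \<in> wt Gr_loc_zero v"
  shows "x \<otimes>\<^bsub>Gr_loc_zero\<^esub> y \<in> wt Gr_loc_zero (u + v)"
proof -
  obtain p m n where p: "hweight (u + (int m, int m)) p" "x = loc_frac p m n"
    using assms by (auto simp: wt_Gr_loc_iff)
  obtain p' m' n' where p': "hweight (v + (int m', int m')) p'" "y = loc_frac p' m' n'"
    using assms by (auto simp: wt_Gr_loc_iff)
  obtain r where r: "Poly_Mapping.keys r \<subseteq> Poly_Mapping.keys p'" "eqv q (p' * denom m n) (denom m n * r)"
    by (rule commute_denomE)
  have "hweight (u + (int m, int m) + (v + (int m', int m'))) (p * r)"
    using hweight_mult[OF p(1) homogeneous_subset[OF p'(1) r(1)]] .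
  also have "u + (int m, int m) + (v + (int m', int m')) = u + v + (int (m' + m), int (m' + m))"
    by (cases u; cases v) simp
  finally have "x \<otimes>\<^bsub>Gr_loc q\<^esub> y \<in> wt (Gr_loc q) (u + v)"
    unfolding wt_Gr_loc_iff p(2) p'(2) loc_frac_mult[OF r(2)] by blast
  then show ?thesis using assms degree_zero_mult by simp
qed

lemma smult_mult_left:
  assumes "x \<in> carrier (Gr_loc q)" "y \<in> carrier (Gr_loc q)"
  shows "(c \<odot>\<^bsub>Gr_loc q\<^esub> x) \<otimes>\<^bsub>Gr_loc q\<^esub> y = c \<odot>\<^bsub>Gr_loc q\<^esub> (x \<otimes>\<^bsub>Gr_loc q\<^esub> y)"
proof -
  obtain p m n where p: "x = loc_frac p m n" using assms Gr_locE by metis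
  obtain p' m' n' where p': "y = loc_frac p' m' n'" using assms Gr_locE by metis
  obtain r where r: "eqv q (p' * denom m n) (denom m n * r)" by (rule commute_denomE)
  show ?thesis by (simp add: p p' loc_frac_smult loc_frac_mult[OF r] mult.assoc)
qed

lemma smult_mult_right:
  assumes "x \<in> carrier (Gr_loc q)" "y \<in> carrier (Gr_loc q)"
  shows "x \<otimes>\<^bsub>Gr_loc q\<^esub> (c \<odot>\<^bsub>Gr_loc q\<^esub> y) = c \<odot>\<^bsub>Gr_loc q\<^esub> (x \<otimes>\<^bsub>Gr_loc q\<^esub> y)"
proof -
  obtain p m n where p: "x = loc_frac p m n" using assms Gr_locE by metis
  obtain p' m' n' where p': "y = loc_frac p' m' n'" using assms Gr_locE by metis
  obtain r where r: "eqv q (p' * denom m n) (denom m n * r)" by (rule commute_denomE)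
  have "eqv q (const c * p' * denom m n) (denom m n * (const c * r))"
    using eqv_left[OF r, of "const c"] const_lcomm[of "denom m n" c r] by (simp add: mult.assoc)
  note cr = loc_frac_mult[OF this]
  show ?thesis by (simp add: p p' loc_frac_smult loc_frac_mult[OF r] cr const_lcomm[of p])
qed

lemma star_smult:
  assumes "x \<in> carrier (Gr_loc q)"
  shows "star (Gr_loc q) (c \<odot>\<^bsub>Gr_loc q\<^esub> x) = cnj c \<odot>\<^bsub>Gr_loc q\<^esub> star (Gr_loc q) x"
proof -
  obtain p m n where p: "x = loc_frac p m n" using assms Gr_locE by metis
  obtain r where r: "eqv q (free_star q p * denom m n) (denom m n * r)" by (rule commute_denomE)
  have "eqv q (free_star q (const c * p) * denom m n) (denom m n * (const (cnj c) * r))"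
    using eqv_left[OF r, of "const (cnj c)"] const_lcomm[of "denom m n" "cnj c" r]
    by (simp add: free_star_mult free_star_const const_comm[of "free_star q p"] mult.assoc)
  then show ?thesis by (simp add: p loc_frac_smult loc_frac_star loc_frac_star[OF r])
qed

lemma module_Gr_loc_zero: "module complex_field Gr_loc_zero"
proof (rule moduleI)
  show "cring complex_field" by (rule cring_from_type_algebra)
  show "abelian_group Gr_loc_zero" ..
  show "c \<odot>\<^bsub>Gr_loc_zero\<^esub> x \<in> carrier Gr_loc_zero" if "x \<in> carrier Gr_loc_zero" for c x
    using that degree_zero_smult by simp
  show "(a \<oplus>\<^bsub>complex_field\<^esub> b) \<odot>\<^bsub>Gr_loc_zero\<^esub> x = (a \<odot>\<^bsub>Gr_loc_zero\<^esub> x) \<oplus>\<^bsub>Gr_loc_zero\<^esub> (b \<odot>\<^bsub>Gr_loc_zero\<^esub> x)" if "x \<in> carrier Gr_loc_zero" for a b x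
    using that by (auto elim!: degree_zeroE simp: loc_frac_smult loc_frac_add const_add distrib_right)
  show "a \<odot>\<^bsub>Gr_loc_zero\<^esub> (x \<oplus>\<^bsub>Gr_loc_zero\<^esub> y) = (a \<odot>\<^bsub>Gr_loc_zero\<^esub> x) \<oplus>\<^bsub>Gr_loc_zero\<^esub> (a \<odot>\<^bsub>Gr_loc_zero\<^esub> y)" if "x \<in> carrier Gr_loc_zero" "y \<in> carrier Gr_loc_zero" for a x y
    using that by (auto elim!: degree_zeroE simp: loc_frac_smult loc_frac_add_cross distrib_left mult.assoc)
  show "(a \<otimes>\<^bsub>complex_field\<^esub> b) \<odot>\<^bsub>Gr_loc_zero\<^esub> x = a \<odot>\<^bsub>Gr_loc_zero\<^esub> (b \<odot>\<^bsub>Gr_loc_zero\<^esub> x)" if "x \<in> carrier Gr_loc_zero" for a b x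
    using that by (auto elim!: degree_zeroE simp: loc_frac_smult const_const)
  show "\<one>\<^bsub>complex_field\<^esub> \<odot>\<^bsub>Gr_loc_zero\<^esub> x = x" if "x \<in> carrier Gr_loc_zero" for x
    using that by (auto elim!: degree_zeroE simp: loc_frac_smult)
qed

lemma submodule_wt_Gr_loc_zero: "submodule (wt Gr_loc_zero w) complex_field Gr_loc_zero"
proof (rule module.submoduleI[OF module_Gr_loc_zero])
  show "wt Gr_loc_zero w \<subseteq> carrier Gr_loc_zero" by auto
  have "\<zero>\<^bsub>Gr_loc q\<^esub> \<in> wt (Gr_loc q) w"
    unfolding wt_Gr_loc_iff by (rule exI[of _ 0]) (simp add: loc_frac_zero)
  then show "\<zero>\<^bsub>Gr_loc_zero\<^esub> \<in> wt Gr_loc_zero w" using A.zero_closed by simp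
  show "\<ominus>\<^bsub>Gr_loc_zero\<^esub> x \<in> wt Gr_loc_zero w" if x: "x \<in> wt Gr_loc_zero w" for x
  proof -
    have "(- 1) \<odot>\<^bsub>Gr_loc_zero\<^esub> x \<oplus>\<^bsub>Gr_loc_zero\<^esub> x = \<zero>\<^bsub>Gr_loc_zero\<^esub>"
      using x by (auto elim!: degree_zeroE simp: loc_frac_smult loc_frac_add const_uminus loc_frac_zero)
    then have "\<ominus>\<^bsub>Gr_loc_zero\<^esub> x = (- 1) \<odot>\<^bsub>Gr_loc_zero\<^esub> x"
      using x wt_Gr_loc_zero_smult[OF x, of "- 1"] by (intro A.minus_equality) auto
    then show ?thesis using wt_Gr_loc_zero_smult[OF x, of "- 1"] by simp
  qed
qed (use wt_Gr_loc_zero_add wt_Gr_loc_zero_smult in blast)+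

lemma comodule_star_algebra_Gr_loc_zero: "comodule_star_algebra Gr_loc_zero"
proof (intro comodule_star_algebra.intro comodule_star_algebra_axioms.intro ring_Gr_loc_zero module_Gr_loc_zero submodule_wt_Gr_loc_zero)
  have carrier: "x \<in> carrier Gr.L" if "x \<in> carrier Gr_loc_zero" for x
    using that degree_zero_carrier by (auto simp: Gr_loc_simps loc_ring_def)
  show "star Gr_loc_zero x \<in> carrier Gr_loc_zero" if "x \<in> carrier Gr_loc_zero" for x
    using that degree_zero_star by simp
  show "star Gr_loc_zero (star Gr_loc_zero x) = x" if "x \<in> carrier Gr_loc_zero" for x
    using Gr.fraction_star_involution[OF carrier[OF that]] by (simp add: Gr_loc_simps)
  show "star Gr_loc_zero (x \<oplus>\<^bsub>Gr_loc_zero\<^esub> y) = star Gr_loc_zero x \<oplus>\<^bsub>Gr_loc_zero\<^esub> star Gr_loc_zero y" if "x \<in> carrier Gr_loc_zero" "y \<in> carrier Gr_loc_zero" for x y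
    using Gr.fraction_star_add[OF that[THEN carrier]] by (simp add: Gr_loc_simps loc_ring_def)
  show "star Gr_loc_zero (x \<otimes>\<^bsub>Gr_loc_zero\<^esub> y) = star Gr_loc_zero y \<otimes>\<^bsub>Gr_loc_zero\<^esub> star Gr_loc_zero x" if "x \<in> carrier Gr_loc_zero" "y \<in> carrier Gr_loc_zero" for x y
    using Gr.fraction_star_mult[OF that[THEN carrier]] by (simp add: Gr_loc_simps loc_ring_def)
  show "\<one>\<^bsub>Gr_loc_zero\<^esub> \<in> wt Gr_loc_zero 0"
  proof -
    have "hweight (0 + (int 0, int 0)) 1" using hweight_one by (simp add: zero_prod_def)
    then have "\<one>\<^bsub>Gr_loc q\<^esub> \<in> wt (Gr_loc q) 0"
      unfolding wt_Gr_loc_iff using loc_frac_one by metis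
    then show ?thesis using A.one_closed by simp
  qed
  show "\<exists>!f. (\<forall>w. f w \<in> wt Gr_loc_zero w) \<and> finite {w. f w \<noteq> \<zero>\<^bsub>Gr_loc_zero\<^esub>} \<and> x = (\<Oplus>\<^bsub>Gr_loc_zero\<^esub>w\<in>{w. f w \<noteq> \<zero>\<^bsub>Gr_loc_zero\<^esub>}. f w)"
    if "x \<in> carrier Gr_loc_zero" for x
  proof (rule ex_ex1I)
    show "\<exists>f. (\<forall>w. f w \<in> wt Gr_loc_zero w) \<and> finite {w. f w \<noteq> \<zero>\<^bsub>Gr_loc_zero\<^esub>} \<and> x = (\<Oplus>\<^bsub>Gr_loc_zero\<^esub>w\<in>{w. f w \<noteq> \<zero>\<^bsub>Gr_loc_zero\<^esub>}. f w)"
      using that by (intro wt_decomposition_exists) simp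
    show "f = g"
      if "(\<forall>w. f w \<in> wt Gr_loc_zero w) \<and> finite {w. f w \<noteq> \<zero>\<^bsub>Gr_loc_zero\<^esub>} \<and> x = (\<Oplus>\<^bsub>Gr_loc_zero\<^esub>w\<in>{w. f w \<noteq> \<zero>\<^bsub>Gr_loc_zero\<^esub>}. f w)"
        "(\<forall>w. g w \<in> wt Gr_loc_zero w) \<and> finite {w. g w \<noteq> \<zero>\<^bsub>Gr_loc_zero\<^esub>} \<and> x = (\<Oplus>\<^bsub>Gr_loc_zero\<^esub>w\<in>{w. g w \<noteq> \<zero>\<^bsub>Gr_loc_zero\<^esub>}. g w)"
      for f g
      by (rule wt_decomposition_unique[of f x g]) (use that in blast)+
  qed
  have Gr_loc: "x \<in> carrier (Gr_loc q)" if "x \<in> carrier Gr_loc_zero" for x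
    using that degree_zero_carrier by auto
  show "(c \<odot>\<^bsub>Gr_loc_zero\<^esub> x) \<otimes>\<^bsub>Gr_loc_zero\<^esub> y = c \<odot>\<^bsub>Gr_loc_zero\<^esub> (x \<otimes>\<^bsub>Gr_loc_zero\<^esub> y)"
    "x \<otimes>\<^bsub>Gr_loc_zero\<^esub> (c \<odot>\<^bsub>Gr_loc_zero\<^esub> y) = c \<odot>\<^bsub>Gr_loc_zero\<^esub> (x \<otimes>\<^bsub>Gr_loc_zero\<^esub> y)" if "x \<in> carrier Gr_loc_zero" "y \<in> carrier Gr_loc_zero" for c x y
    using smult_mult_left smult_mult_right that[THEN Gr_loc] by simp_all
  show "star Gr_loc_zero (c \<odot>\<^bsub>Gr_loc_zero\<^esub> x) = cnj c \<odot>\<^bsub>Gr_loc_zero\<^esub> star Gr_loc_zero x" if "x \<in> carrier Gr_loc_zero" for c x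
    using star_smult[OF Gr_loc[OF that]] by simp
  show "x \<otimes>\<^bsub>Gr_loc_zero\<^esub> y \<in> wt Gr_loc_zero (u + v)" if "x \<in> wt Gr_loc_zero u" "y \<in> wt Gr_loc_zero v" for x y u v
    using that by (rule wt_Gr_loc_zero_mult)
qed

text \<open>Both records take star and operations from \<open>Gr_loc q\<close> and cut its weight
  spaces down to the carrier, so equality of the generated subrings makes the whole records
  equal.\<close>

lemma R4_adjoin_eq: "R4_adjoin_rho_tilde q = Gr_loc_zero"
  and R4_tilde_adjoin_eq: "rho_adjoin_R4_tilde q = Gr_loc_zero"
  by (simp_all add: R4_adjoin_rho_tilde_def rho_adjoin_R4_tilde_def generated_subalgebra_def
      generate_R4 generate_R4_tilde Gr_loc_zero_def)

end

theorem proposition3p25: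
  fixes q :: real
  assumes "0 < q"
  shows "comodule_star_isomorphic (R4_adjoin_rho_tilde q) (rho_adjoin_R4_tilde q)"
proof -
  let ?A = "Gr_loc_zero q"
  have "(\<lambda>x. x) \<in> comodule_star_iso ?A ?A"
    by (auto simp: comodule_star_iso_def ring_iso_def bij_betw_def intro: ring_hom_memI)
  then have "comodule_star_isomorphic ?A ?A"
    using comodule_star_algebra_Gr_loc_zero[OF assms] by (auto simp: comodule_star_isomorphic_def)
  then show ?thesis
    by (simp add: R4_adjoin_eq[OF assms] R4_tilde_adjoin_eq[OF assms])
qed

end
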